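(* Let $p\in\mathbb{N}$ and let $\boldsymbol{\mu}=(\mu^{i,j})_{i,j=1,\dots,p}$ be a $p\times p$ matrix of locally finite measures concentrated on $\mathbb{N}_0=\{0,1,2,\dots\}$. Let $\vartheta\in\mathbb{R}$ lie in the interior of $\mathcal{D}(\mathcal{L}\boldsymbol{\mu})$ and suppose that the spectral radius of the matrix $\boldsymbol{\mu}(0)=(\mu^{i,j}(\{0\}))_{i,j}$ is strictly smaller than $1$. Further, assume that there exists some $\theta>\vartheta$ such that $\Lambda_\vartheta=\Lambda_\theta$. Then, for any $f:\mathbb{N}_0\to\mathbb{R}^p$ such that the series $$\sum_{n=0}^\infty f(n)e^{-\theta n}$$ converges (to a finite limit in each component), there exist vectors $b_{\lambda,k,f}\in\mathbb{C}^p$, $k=0,\dots,\mathtt{k}(\lambda)-1$, $\lambda\in\Lambda_\theta$, such that $$F(n)=\sum_{\lambda\in\Lambda_\theta}e^{\lambda n}\sum_{k=0}^{\mathtt{k}(\lambda)-1}n^k\,b_{\lambda,k,f}+O(e^{\theta n})\quad\text{as }n\to\infty,$$ where $F$ is the unique locally bounded solution of the discrete Markov renewal equation $F(n)=f(n)+\boldsymbol{\mu}*F(n)$, $n\in\mathbb{N}_0$.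
   Context: $\mathbf{I}_p$ is the $p\times p$ identity matrix. $\mathcal{L}\boldsymbol{\mu}(z)=(\mathcal{L}\mu^{i,j}(z))_{i,j}$ with $\mathcal{L}\mu^{i,j}(z)=\int_{[0,\infty)} e^{-zx}\,\mu^{i,j}(\mathrm{d}x)=\sum_{n\ge0}\mu^{i,j}(\{n\})e^{-zn}$, and $$\mathcal{D}(\mathcal{L}\boldsymbol{\mu})=\Big\{z\in\mathbb{C}:\int e^{-\mathrm{Re}(z)x}\,\mu^{i,j}(\mathrm{d}x)<\infty\text{ for all }i,j\Big\}.$$ Roots (lattice case, span $1$): $\Lambda=\{\lambda=\sigma+\mathrm{i}\eta\in\mathcal{D}(\mathcal{L}\boldsymbol{\mu}):-\pi<\eta\le\pi,\ \det(\mathbf{I}_p-\mathcal{L}\boldsymbol{\mu}(\lambda))=0\}$ and, for $\theta\in\mathbb{R}$, $\Lambda_\theta=\{\lambda\in\Lambda:\mathrm{Re}(\lambda)>\theta\}$. For $\lambda\in\Lambda$, $\mathtt{k}(\lambda)\in\mathbb{N}=\{1,2,\dots\}$ is the smallest natural number such that all entries of $(z-\lambda)^{\mathtt{k}(\lambda)}(\mathbf{I}_p-\mathcal{L}\boldsymbol{\mu}(z))^{-1}$ are holomorphic in some neighborhood of $\lambda$. Discrete convolution: $(\boldsymbol{\mu}*F)_i(n)=\sum_{j=1}^p\sum_{m=0}^n\mu^{i,j}(\{m\})F_j(n-m)$. With $\boldsymbol{U}=\sum_{l\ge0}\boldsymbol{\mu}^{*l}$ (matrix convolution powers, $\boldsymbol{\mu}^{*0}=\mathbf{I}_p\delta_0$),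 the solution is $F=\boldsymbol{U}*f$. The error bound is to be read component by component. *)

theory Defs
  imports
    "HOL-Complex_Analysis.Complex_Analysis"
    "HOL-Library.Landau_Symbols"
    "Jordan_Normal_Form.Gauss_Jordan_Elimination"
    "Jordan_Normal_Form.Spectral_Radius"
begin

text \<open>
  Matrices and vectors are those of \<open>Jordan_Normal_Form\<close>, with indices running over
  \<open>0, \<dots>, p - 1\<close>; the notation \<open>$\<close> of the Analysis vectors is switched off.
  A matrix of measures is a function \<open>\<mu> i j\<close> of which only the entries with
  \<open>i < p\<close> and \<open>j < p\<close> matter.
\<close>

no_notation Finite_Cartesian_Product.vec_nth (infixl \<open>$\<close> 90)

text \<open>Locally finite (Borel) measures on the real line that are concentrated on \<open>{0, 1, 2, \<dots>}\<close>.\<close>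

definition lattice_measure :: "real measure \<Rightarrow> bool" where
  "lattice_measure M \<longleftrightarrow>
     sets M = sets borel \<and>
     (\<forall>K. compact K \<longrightarrow> emeasure M K < \<infinity>) \<and>
     emeasure M (- \<nat>) = 0"

definition laplace_mat :: "nat \<Rightarrow> (nat \<Rightarrow> nat \<Rightarrow> real measure) \<Rightarrow> complex \<Rightarrow> complex mat" where
  "laplace_mat p \<mu> z =
     mat p p (\<lambda>(i, j). LINT x:{0..}|\<mu> i j. exp (- z * complex_of_real x))"

definition laplace_dom :: "nat \<Rightarrow> (nat \<Rightarrow> nat \<Rightarrow> real measure) \<Rightarrow> complex set" where
  "laplace_dom p \<mu> =
     {z. \<forall>i<p. \<forall>j<p. (\<integral>\<^sup>+ x. ennreal (exp (- Re z * x)) \<partial>\<mu> i j) < \<infinity>}"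

definition char_roots :: "nat \<Rightarrow> (nat \<Rightarrow> nat \<Rightarrow> real measure) \<Rightarrow> complex set" where
  "char_roots p \<mu> =
     {z \<in> laplace_dom p \<mu>. - pi < Im z \<and> Im z \<le> pi \<and>
        Determinant.det (1\<^sub>m p - laplace_mat p \<mu> z) = 0}"

definition char_roots_above :: "nat \<Rightarrow> (nat \<Rightarrow> nat \<Rightarrow> real measure) \<Rightarrow> real \<Rightarrow> complex set" where
  "char_roots_above p \<mu> \<theta> = {z \<in> char_roots p \<mu>. Re z > \<theta>}"

text \<open>
  At a root \<open>w\<close> itself the inverse of \<open>1\<^sub>m p - laplace_mat p \<mu> w\<close> does not exist, so
  holomorphy near \<open>w\<close> means: the inverse exists on a punctured ball around \<open>w\<close>, and each
  entry, multiplied by \<open>(z - w) ^ k\<close>, extends holomorphically to the full ball.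
\<close>

definition resolvent_holomorphic ::
    "nat \<Rightarrow> (nat \<Rightarrow> nat \<Rightarrow> real measure) \<Rightarrow> complex \<Rightarrow> nat \<Rightarrow> bool" where
  "resolvent_holomorphic p \<mu> w k \<longleftrightarrow>
     (\<exists>r>0. ball w r \<subseteq> laplace_dom p \<mu> \<and>
       (\<exists>G :: nat \<Rightarrow> nat \<Rightarrow> complex \<Rightarrow> complex.
          (\<forall>i<p. \<forall>j<p. G i j holomorphic_on ball w r) \<and>
          (\<forall>z \<in> ball w r - {w}. \<exists>R.
             mat_inverse (1\<^sub>m p - laplace_mat p \<mu> z) = Some R \<and>
             (\<forall>i<p. \<forall>j<p. G i j z = (z - w) ^ k * R $$ (i, j)))))"

definition root_order :: "nat \<Rightarrow> (nat \<Rightarrow> nat \<Rightarrow> real measure) \<Rightarrow> complex \<Rightarrow> nat" where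
  "root_order p \<mu> w = (LEAST k. 1 \<le> k \<and> resolvent_holomorphic p \<mu> w k)"

definition mass_mat :: "nat \<Rightarrow> (nat \<Rightarrow> nat \<Rightarrow> real measure) \<Rightarrow> nat \<Rightarrow> real mat" where
  "mass_mat p \<mu> m = mat p p (\<lambda>(i, j). measure (\<mu> i j) {real m})"

definition disc_conv ::
    "nat \<Rightarrow> (nat \<Rightarrow> nat \<Rightarrow> real measure) \<Rightarrow> (nat \<Rightarrow> real Matrix.vec) \<Rightarrow> nat \<Rightarrow> real Matrix.vec" where
  "disc_conv p \<mu> F n =
     Matrix.vec p (\<lambda>i. \<Sum>j<p. \<Sum>m\<le>n. mass_mat p \<mu> m $$ (i, j) * F (n - m) $ j)"

text \<open>For a sequence, local boundedness holds trivially; it is kept to match the notion of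
  solution used for general renewal equations.\<close>

definition locally_bounded_seq :: "nat \<Rightarrow> (nat \<Rightarrow> real Matrix.vec) \<Rightarrow> bool" where
  "locally_bounded_seq p F \<longleftrightarrow> (\<forall>i<p. \<forall>N. bounded ((\<lambda>n. F n $ i) ` {..N}))"

definition markov_renewal_solution ::
    "nat \<Rightarrow> (nat \<Rightarrow> nat \<Rightarrow> real measure) \<Rightarrow> (nat \<Rightarrow> real Matrix.vec)
       \<Rightarrow> (nat \<Rightarrow> real Matrix.vec) \<Rightarrow> bool" where
  "markov_renewal_solution p \<mu> f F \<longleftrightarrow>
     (\<forall>n. F n \<in> carrier_vec p) \<and>
     locally_bounded_seq p F \<and>
     (\<forall>n. F n = f n + disc_conv p \<mu> F n)"

end

theory Submission
  imports Defs "HOL-Real_Asymp.Real_Asymp"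
begin

text \<open>
  In the variable \<open>s = exp (- z)\<close> the Laplace transform becomes the power series
  \<open>\<Sum> \<mu>({n}) s ^ n\<close>, and the renewal equation becomes the linear system
  \<open>(1 - \<Sum> \<mu>({n}) s ^ n) F(s) = f(s)\<close> over formal power series, solved by Cramer's rule.
  The entries of the inverse matrix, adjugate over determinant, are meromorphic on
  \<open>|s| < exp (- \<theta>\<^sub>0)\<close> with poles only at \<open>exp (- w)\<close> for roots \<open>w\<close>, all of which satisfy
  \<open>|exp (- w)| < exp (- \<theta>)\<close>. After subtracting the principal parts, the remaining coefficients are
  summable against \<open>exp (- \<theta> n)\<close> and hence contribute \<open>O(exp (\<theta> n))\<close> to the convolution with
  \<open>f(n) = O(exp (\<theta> n))\<close>. A principal part contributes sums over \<open>m \<le> n\<close> of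
  \<open>(n - m) ^ k exp (w (n - m)) f(m)\<close>; completing them to sums over all \<open>m\<close> gives
  \<open>exp (w n)\<close> times a polynomial in \<open>n\<close>, and the tail is \<open>O(exp (\<theta> n))\<close> because \<open>Re w > \<theta>\<close>.
\<close>

section \<open>Sequences with exponential-polynomial asymptotics\<close>

text \<open>Stated for one scalar sequence, with the coefficients hidden behind an existential: this
  makes the property closed under linear combinations, so separate contributions can be collected
  term by term. \<open>K w\<close> limits the powers of \<open>n\<close> allowed next to
  \<open>exp (w * n)\<close>.\<close>

definition exp_poly_approx ::
    "complex set \<Rightarrow> (complex \<Rightarrow> nat) \<Rightarrow> real \<Rightarrow> (nat \<Rightarrow> complex) \<Rightarrow> bool" where
  "exp_poly_approx W K \<theta> g \<longleftrightarrow>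
     (\<exists>b. (\<lambda>n. g n - (\<Sum>w\<in>W. exp (w * of_nat n) * (\<Sum>k<K w. of_nat n ^ k * b w k)))
            \<in> O(\<lambda>n. complex_of_real (exp (\<theta> * real n))))"

lemma exp_poly_approx_bigo:
  assumes "g \<in> O(\<lambda>n. complex_of_real (exp (\<theta> * real n)))"
  shows "exp_poly_approx W K \<theta> g"
  unfolding exp_poly_approx_def using assms by (intro exI[of _ "\<lambda>_ _. 0"]) simp

lemma exp_poly_approx_add:
  assumes "exp_poly_approx W K \<theta> g" "exp_poly_approx W K \<theta> h"
  shows "exp_poly_approx W K \<theta> (\<lambda>n. g n + h n)"
proof -
  from assms obtain b c where
    "(\<lambda>n. g n - (\<Sum>w\<in>W. exp (w * of_nat n) * (\<Sum>k<K w. of_nat n ^ k * b w k)))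
            \<in> O(\<lambda>n. complex_of_real (exp (\<theta> * real n)))"
    "(\<lambda>n. h n - (\<Sum>w\<in>W. exp (w * of_nat n) * (\<Sum>k<K w. of_nat n ^ k * c w k)))
            \<in> O(\<lambda>n. complex_of_real (exp (\<theta> * real n)))"
    unfolding exp_poly_approx_def by blast
  from sum_in_bigo(1)[OF this] show ?thesis
    unfolding exp_poly_approx_def
    by (intro exI[of _ "\<lambda>w k. b w k + c w k"])
       (simp add: ring_distribs sum.distrib add_diff_add)
qed

lemma exp_poly_approx_cmult:
  assumes "exp_poly_approx W K \<theta> g"
  shows "exp_poly_approx W K \<theta> (\<lambda>n. c * g n)"
proof -
  from assms obtain b where
    "(\<lambda>n. g n - (\<Sum>w\<in>W. exp (w * of_nat n) * (\<Sum>k<K w. of_nat n ^ k * b w k)))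
            \<in> O(\<lambda>n. complex_of_real (exp (\<theta> * real n)))"
    unfolding exp_poly_approx_def by blast
  hence "(\<lambda>n. c * (g n - (\<Sum>w\<in>W. exp (w * of_nat n) * (\<Sum>k<K w. of_nat n ^ k * b w k))))
            \<in> O(\<lambda>n. complex_of_real (exp (\<theta> * real n)))"
    by (cases "c = 0") simp_all
  thus ?thesis
    unfolding exp_poly_approx_def
    by (intro exI[of _ "\<lambda>w k. c * b w k"])
       (simp add: ring_distribs sum_distrib_left mult_ac)
qed

lemma exp_poly_approx_sum:
  assumes "\<And>i. i \<in> I \<Longrightarrow> exp_poly_approx W K \<theta> (g i)"
  shows "exp_poly_approx W K \<theta> (\<lambda>n. \<Sum>i\<in>I. g i n)"
  using assms
  by (induction I rule: infinite_finite_induct)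
     (auto intro: exp_poly_approx_add exp_poly_approx_bigo)

lemma exp_poly_approx_monomial:
  assumes "finite W" "w \<in> W" "k < K w"
  shows "exp_poly_approx W K \<theta> (\<lambda>n. exp (w * of_nat n) * of_nat n ^ k)"
proof -
  define b where "b = (\<lambda>v l. if v = w \<and> l = k then 1 else (0::complex))"
  have "(\<Sum>v\<in>W. exp (v * of_nat n) * (\<Sum>l<K v. of_nat n ^ l * b v l))
          = exp (w * of_nat n) * of_nat n ^ k" for n
  proof -
    have "(\<Sum>l<K v. of_nat n ^ l * b v l) = (if v = w then of_nat n ^ k else 0)" for v
    proof -
      have "(\<Sum>l<K v. of_nat n ^ l * b v l)
              = (\<Sum>l<K v. if l = k then (if v = w then of_nat n ^ k else 0) else 0)"
        by (intro sum.cong) (auto simp: b_def)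
      also have "\<dots> = (if v = w then of_nat n ^ k else 0)"
        using assms by (subst sum.delta) auto
      finally show ?thesis .
    qed
    thus ?thesis using assms
      by (simp add: if_distrib[of "\<lambda>x. _ * x"] cong: if_cong)
  qed
  thus ?thesis unfolding exp_poly_approx_def by (intro exI[of _ b]) simp
qed

section \<open>Convolutions of exponential polynomials with sequences of growth
  \<open>exp (\<theta> * n)\<close>\<close>

lemma summable_power_times_geometric:
  fixes x :: real
  assumes "0 < x" "x < 1"
  shows "summable (\<lambda>m. real m ^ j * x ^ m)"
proof (rule summable_comparison_test_bigo)
  \<comment> \<open>Half of the exponential decay absorbs the polynomial factor; the other half
    leaves a geometric series.\<close>
  define \<delta> where "\<delta> = - ln x"
  have d: "\<delta> > 0" "x = exp (-\<delta>)" using assms by (auto simp: \<delta>_def)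
  show "summable (\<lambda>m. norm (exp (-\<delta>/2) ^ m))"
    using d by (simp add: norm_power summable_geometric)
  have "(\<lambda>m. real m ^ j * exp (-\<delta> * real m)) \<in> O(\<lambda>m. exp (-\<delta>/2 * real m))"
    using d by real_asymp
  thus "(\<lambda>m. real m ^ j * x ^ m) \<in> O(\<lambda>m. exp (-\<delta>/2) ^ m)"
    using d by (simp add: exp_of_nat_mult[symmetric] mult_ac)
qed

lemma exp_poly_approx_conv_monomial:
  fixes f :: "nat \<Rightarrow> complex"
  assumes W: "finite W" "w \<in> W" "k < K w" and w: "Re w > \<theta>"
    and f: "\<And>m. norm (f m) \<le> C * exp (\<theta> * real m)"
  shows "exp_poly_approx W K \<theta>
           (\<lambda>n. \<Sum>m\<le>n. exp (w * of_nat (n - m)) * of_nat (n - m) ^ k * f m)"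
proof -
  \<comment> \<open>The ratio of the geometric bound on \<open>exp (- w * m) * f m\<close>; the
    strict gap between \<open>Re w\<close> and \<theta> puts it below 1.\<close>
  define x where "x = exp (\<theta> - Re w)"
  have x: "0 < x" "x < 1" using w by (auto simp: x_def)
  have C: "C \<ge> 0" using order.trans[OF norm_ge_zero f[of 0]] by simp
  define c where "c m = exp (- w * of_nat m) * f m" for m
  have xm: "x ^ m = exp (- (Re w) * real m) * exp (\<theta> * real m)" for m
    by (simp add: x_def exp_add [symmetric] exp_of_nat_mult[symmetric] algebra_simps)
  have c: "norm (c m) \<le> C * x ^ m" for m
  proof -
    have "norm (c m) = exp (- (Re w) * real m) * norm (f m)"
      by (simp add: c_def norm_mult norm_exp_eq_Re)
    also have "\<dots> \<le> exp (- (Re w) * real m) * (C * exp (\<theta> * real m))"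
      by (intro mult_left_mono f) auto
    finally show ?thesis by (simp add: xm mult_ac)
  qed
  have summ: "summable (\<lambda>m. (- of_nat m) ^ j * c m)" for j
  proof (rule summable_comparison_test)
    show "summable (\<lambda>m. C * (real m ^ j * x ^ m))"
      by (intro summable_mult summable_power_times_geometric x)
    show "\<exists>N. \<forall>m\<ge>N. norm ((- of_nat m) ^ j * c m) \<le> C * (real m ^ j * x ^ m)"
    proof (intro exI[of _ 0] allI impI)
      fix m
      have "real m ^ j * norm (c m) \<le> real m ^ j * (C * x ^ m)"
        by (intro mult_left_mono c) auto
      thus "norm ((- of_nat m) ^ j * c m) \<le> C * (real m ^ j * x ^ m)"
        by (simp add: norm_mult norm_power mult_ac)
    qed
  qed
  \<comment> \<open>The completed series also has terms with \<open>m > n\<close>, so the difference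
    is formed in the complex numbers and not by truncated subtraction.\<close>
  define S where "S n = (\<Sum>m. (of_nat n - of_nat m) ^ k * c m)" for n :: nat
  have binom: "(of_nat n - of_nat m) ^ k * c m =
       (\<Sum>j\<le>k. of_nat (k choose j) * of_nat n ^ j * ((- of_nat m) ^ (k - j) * c m))" for n m
    using binomial_ring[of "of_nat n :: complex" "- of_nat m" k]
    by (simp add: sum_distrib_left mult_ac)
  have S: "S n = (\<Sum>j\<le>k. of_nat (k choose j) * of_nat n ^ j * (\<Sum>m. (- of_nat m) ^ (k - j) * c m))" for n
    unfolding S_def binom by (subst suminf_sum) (auto intro!: summable_mult summ sum.cong suminf_mult)
  have summS: "summable (\<lambda>m. (of_nat n - of_nat m) ^ k * c m)" for n
    unfolding binom by (intro summable_sum summable_mult summ)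
  have main: "exp_poly_approx W K \<theta> (\<lambda>n. exp (w * of_nat n) * S n)"
  proof -
    have "exp_poly_approx W K \<theta> (\<lambda>n. \<Sum>j\<le>k. (of_nat (k choose j) *
            (\<Sum>m. (- of_nat m) ^ (k - j) * c m)) * (exp (w * of_nat n) * of_nat n ^ j))"
      using W by (intro exp_poly_approx_sum exp_poly_approx_cmult exp_poly_approx_monomial) auto
    thus ?thesis by (simp add: S sum_distrib_left mult_ac)
  qed
  \<comment> \<open>For \<open>m = l + Suc n\<close> the tail term is at most
    \<open>C * x ^ n\<close> times the \<open>l\<close>-th term of \<open>D\<close>, and
    \<open>exp (Re w * n) * x ^ n = exp (\<theta> * n)\<close>. Hence the tail constant does not
    depend on \<open>n\<close>.\<close>
  define D where "D = (\<Sum>l. real (Suc l) ^ k * x ^ Suc l)"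
  have sD: "summable (\<lambda>l. real (Suc l) ^ k * x ^ Suc l)"
    using summable_power_times_geometric[OF x, of k] by (subst summable_Suc_iff)
  have tail: "norm (exp (w * of_nat n) * (\<Sum>l. (of_nat n - of_nat (l + Suc n)) ^ k * c (l + Suc n)))
                \<le> C * D * exp (\<theta> * real n)" for n
  proof -
    have b: "norm ((of_nat n - of_nat (l + Suc n)) ^ k * c (l + Suc n))
            \<le> C * x ^ n * (real (Suc l) ^ k * x ^ Suc l)" for l
    proof -
      have "of_nat n - of_nat (l + Suc n) = - (of_nat (Suc l) :: complex)" by simp
      hence "norm ((of_nat n - of_nat (l + Suc n)) ^ k * c (l + Suc n)) = 
              real (Suc l) ^ k * norm (c (l + Suc n))"
        by (simp only: norm_mult norm_power norm_minus_cancel norm_of_nat)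
      also have "\<dots> \<le> real (Suc l) ^ k * (C * x ^ (l + Suc n))"
        by (intro mult_left_mono c) auto
      finally show ?thesis by (simp add: power_add mult_ac)
    qed
    have "norm (\<Sum>l. (of_nat n - of_nat (l + Suc n)) ^ k * c (l + Suc n))
            \<le> (\<Sum>l. C * x ^ n * (real (Suc l) ^ k * x ^ Suc l))"
      by (rule norm_suminf_le[OF b]) (intro summable_mult sD)
    also have "\<dots> = C * x ^ n * D"
      unfolding D_def by (rule suminf_mult[OF sD])
    finally have "norm (exp (w * of_nat n)) * norm (\<Sum>l. (of_nat n - of_nat (l + Suc n)) ^ k * c (l + Suc n))
       \<le> exp (Re w * real n) * (C * x ^ n * D)"
      by (intro mult_mono) (auto simp: norm_exp_eq_Re)
    also have "\<dots> = C * D * exp (\<theta> * real n)"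
      by (simp add: xm exp_minus field_simps)
    finally show ?thesis by (simp add: norm_mult)
  qed
  \<comment> \<open>The tail enters as a summand with factor \<open>- 1\<close>, the shape to which
    closure under addition and scalar multiples applies.\<close>
  have eq: "(\<Sum>m\<le>n. exp (w * of_nat (n - m)) * of_nat (n - m) ^ k * f m) =
        exp (w * of_nat n) * S n + - 1 *
        (exp (w * of_nat n) * (\<Sum>l. (of_nat n - of_nat (l + Suc n)) ^ k * c (l + Suc n)))" for n
  proof -
    have "(\<Sum>m\<le>n. exp (w * of_nat (n - m)) * of_nat (n - m) ^ k * f m) =
          exp (w * of_nat n) * (\<Sum>m\<le>n. (of_nat n - of_nat m) ^ k * c m)"
      unfolding sum_distrib_left
      by (intro sum.cong) (auto simp: c_def of_nat_diff exp_add[symmetric] exp_diff exp_minus field_simps)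
    also have "(\<Sum>m\<le>n. (of_nat n - of_nat m) ^ k * c m) = S n -
        (\<Sum>l. (of_nat n - of_nat (l + Suc n)) ^ k * c (l + Suc n))"
      unfolding S_def suminf_split_initial_segment[OF summS, of n "Suc n"] lessThan_Suc_atMost
      by simp
    finally show ?thesis by (simp add: algebra_simps)
  qed
  show ?thesis unfolding eq
    by (intro exp_poly_approx_add main exp_poly_approx_cmult exp_poly_approx_bigo
          bigoI[where c = "C * D"] always_eventually allI)
       (use tail in simp)
qed

text \<open>Up to constants and a geometric factor, these binomials are the Taylor coefficients of a
  pole of order \<open>j + 1\<close>. The induction multiplies by
  \<open>(n + j + 1) / (j + 1)\<close>, which raises the degree by at most one.\<close>

lemma binomial_as_poly:
  "\<exists>P :: complex poly. degree P \<le> j \<and> (\<forall>n. poly P (of_nat n) = of_nat ((n + j) choose j))"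
proof (induction j)
  case 0
  show ?case by (intro exI[of _ 1]) simp
next
  case (Suc j)
  then obtain P :: "complex poly"
    where P: "degree P \<le> j" "\<And>n. poly P (of_nat n) = of_nat ((n + j) choose j)" by blast
  let ?Q = "Polynomial.smult (1 / of_nat (Suc j)) ([:of_nat (Suc j), 1:] * P)"
  have "degree ?Q \<le> Suc j"
    using degree_mult_le[of "[:of_nat (Suc j), 1:]" P] P(1) by (simp add: le_trans)
  moreover have "poly ?Q (of_nat n) = of_nat ((n + Suc j) choose Suc j)" for n
  proof -
    have "of_nat (Suc j) * of_nat ((n + Suc j) choose Suc j)
            = (of_nat (Suc (n + j)) * of_nat ((n + j) choose j) :: complex)"
      unfolding of_nat_mult[symmetric] add_Suc_right Suc_times_binomial ..
    moreover have "of_nat (Suc j) \<noteq> (0 :: complex)" by (simp only: of_nat_eq_0_iff)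
    ultimately have "of_nat ((n + Suc j) choose Suc j)
        = of_nat (Suc (n + j)) * of_nat ((n + j) choose j) / (of_nat (Suc j) :: complex)"
      by (metis nonzero_mult_div_cancel_left)
    thus ?thesis
      by (simp add: P(2) algebra_simps add_divide_distrib)
  qed
  ultimately show ?case by blast
qed

lemma exp_poly_approx_conv_poly:
  fixes f :: "nat \<Rightarrow> complex"
  assumes "finite W" "w \<in> W" "degree P < K w" "Re w > \<theta>"
    and "\<And>m. norm (f m) \<le> C * exp (\<theta> * real m)"
  shows "exp_poly_approx W K \<theta>
           (\<lambda>n. \<Sum>m\<le>n. exp (w * of_nat (n - m)) * poly P (of_nat (n - m)) * f m)"
proof -
  have "exp_poly_approx W K \<theta> (\<lambda>n. \<Sum>k\<le>degree P. coeff P k *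
          (\<Sum>m\<le>n. exp (w * of_nat (n - m)) * of_nat (n - m) ^ k * f m))"
    using assms by (intro exp_poly_approx_sum exp_poly_approx_cmult exp_poly_approx_conv_monomial) auto
  also have "(\<lambda>n. \<Sum>k\<le>degree P. coeff P k *
          (\<Sum>m\<le>n. exp (w * of_nat (n - m)) * of_nat (n - m) ^ k * f m))
       = (\<lambda>n. \<Sum>m\<le>n. exp (w * of_nat (n - m)) * poly P (of_nat (n - m)) * f m)"
  proof
    fix n
    have "(\<Sum>k\<le>degree P. coeff P k *
            (\<Sum>m\<le>n. exp (w * of_nat (n - m)) * of_nat (n - m) ^ k * f m))
         = (\<Sum>k\<le>degree P. \<Sum>m\<le>n. exp (w * of_nat (n - m)) * (coeff P k * of_nat (n - m) ^ k) * f m)"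
      by (simp add: sum_distrib_left mult_ac)
    also have "\<dots> = (\<Sum>m\<le>n. \<Sum>k\<le>degree P. exp (w * of_nat (n - m)) * (coeff P k * of_nat (n - m) ^ k) * f m)"
      by (rule sum.swap)
    also have "\<dots> = (\<Sum>m\<le>n. exp (w * of_nat (n - m)) * poly P (of_nat (n - m)) * f m)"
      by (simp only: poly_altdef sum_distrib_left sum_distrib_right)
    finally show "(\<Sum>k\<le>degree P. coeff P k *
            (\<Sum>m\<le>n. exp (w * of_nat (n - m)) * of_nat (n - m) ^ k * f m))
         = (\<Sum>m\<le>n. exp (w * of_nat (n - m)) * poly P (of_nat (n - m)) * f m)" .
  qed
  finally show ?thesis .
qed

text \<open>Taking \<open>exp (\<theta> * n)\<close> out of \<open>exp (\<theta> * m)\<close> leaves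
  the weight \<open>exp (- \<theta> * (n - m))\<close> on \<open>h (n - m)\<close>. What remains is
  a partial sum of the convergent series, in reverse order.\<close>

lemma conv_summable_bigo:
  fixes h f :: "nat \<Rightarrow> complex"
  assumes h: "summable (\<lambda>n. norm (h n) * exp (- \<theta> * real n))"
    and f: "\<And>m. norm (f m) \<le> C * exp (\<theta> * real m)"
  shows "(\<lambda>n. \<Sum>m\<le>n. h (n - m) * f m) \<in> O(\<lambda>n. complex_of_real (exp (\<theta> * real n)))"
proof (intro bigoI[where c = "C * (\<Sum>n. norm (h n) * exp (- \<theta> * real n))"] always_eventually allI)
  fix n
  let ?g = "\<lambda>n. norm (h n) * exp (- \<theta> * real n)"
  have C: "C \<ge> 0" using order.trans[OF norm_ge_zero f[of 0]] by simp
  have "norm (\<Sum>m\<le>n. h (n - m) * f m) \<le> (\<Sum>m\<le>n. norm (h (n - m)) * (C * exp (\<theta> * real m)))"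
    by (intro sum_norm_le) (auto simp: norm_mult intro!: mult_left_mono f)
  also have "\<dots> = C * exp (\<theta> * real n) * (\<Sum>m\<le>n. ?g (n - m))"
    unfolding sum_distrib_left
    by (intro sum.cong) (auto simp: of_nat_diff exp_diff exp_minus exp_add field_simps)
  also have "(\<Sum>m\<le>n. ?g (n - m)) = (\<Sum>m<Suc n. ?g m)"
    using sum.nat_diff_reindex[of ?g "Suc n"] by (simp add: lessThan_Suc_atMost)
  also have "C * exp (\<theta> * real n) * \<dots> \<le> C * exp (\<theta> * real n) * (\<Sum>n. ?g n)"
    using C by (intro mult_left_mono sum_le_suminf h) auto
  finally show "norm (\<Sum>m\<le>n. h (n - m) * f m)
      \<le> C * (\<Sum>n. ?g n) * norm (complex_of_real (exp (\<theta> * real n)))"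
    using C by (simp add: mult_ac del: mult_le_cancel_left mult_le_cancel_right)
qed

section \<open>Principal parts and coefficient asymptotics\<close>

text \<open>Induction on the order bound: it drops by one for \<open>(s - a) * f s\<close>, and
  dividing the decomposition of that function by \<open>s - a\<close> gives one for
  \<open>f\<close>. The base case is Riemann's theorem on removable singularities. The bound may
  exceed the true pole order.\<close>

lemma principal_part_at:
  fixes f :: "complex \<Rightarrow> complex"
  assumes "open T" "a \<in> T" "f holomorphic_on T - {a}"
    and "(\<lambda>s. (s - a) ^ k * f s) \<in> O[at a](\<lambda>_. 1)"
  shows "\<exists>c H. H holomorphic_on T \<and>
           (\<forall>s\<in>T - {a}. f s = H s + (\<Sum>j<k. c j / (s - a) ^ Suc j))"
  using assms(3,4)
proof (induction k arbitrary: f)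
  case 0
  from 0(2) obtain B where "eventually (\<lambda>s. norm (f s) \<le> B) (at a)"
    by (auto elim!: landau_o.bigE)
  moreover have "a \<in> interior T" using assms(1,2) by (simp add: interior_open)
  ultimately obtain H where "H holomorphic_on T" "\<forall>s\<in>T - {a}. H s = f s"
    using holomorphic_on_extend_bounded 0(1) by blast
  thus ?case by (intro exI[of _ H] exI[of _ "\<lambda>_. 0"]) auto
next
  case (Suc k)
  have "\<exists>c H. H holomorphic_on T \<and>
           (\<forall>s\<in>T - {a}. (s - a) * f s = H s + (\<Sum>j<k. c j / (s - a) ^ Suc j))"
    using Suc.prems by (intro Suc.IH holomorphic_intros) (auto simp: mult_ac)
  then obtain c H where H: "H holomorphic_on T"
      "\<And>s. s \<in> T - {a} \<Longrightarrow> (s - a) * f s = H s + (\<Sum>j<k. c j / (s - a) ^ Suc j)"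
    by blast
  \<comment> \<open>\<open>G\<close> is the difference quotient of \<open>H\<close> at
    \<open>a\<close>, completed by the derivative. The value \<open>H a\<close> becomes the
    coefficient of \<open>1 / (s - a)\<close>, and the old coefficients move up one order.\<close>
  define G where "G = (\<lambda>z. if z = a then deriv H a else (H z - H a) / (z - a))"
  define d where "d j = (case j of 0 \<Rightarrow> H a | Suc j \<Rightarrow> c j)" for j
  have "G holomorphic_on T"
    unfolding G_def by (rule pole_lemma_open) (use H assms in auto)
  moreover have "f s = G s + (\<Sum>j<Suc k. d j / (s - a) ^ Suc j)" if s: "s \<in> T - {a}" for s
  proof -
    have ne: "s - a \<noteq> 0" using s by auto
    have "f s = ((s - a) * f s) / (s - a)" using ne by simp
    also have "\<dots> = H s / (s - a) + (\<Sum>j<k. c j / (s - a) ^ Suc (Suc j))"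
      unfolding H(2)[OF s] using ne by (simp add: add_divide_distrib sum_divide_distrib mult_ac)
    also have "H s / (s - a) = G s + H a / (s - a)"
      using ne by (simp add: G_def diff_divide_distrib)
    also have "G s + H a / (s - a) + (\<Sum>j<k. c j / (s - a) ^ Suc (Suc j))
                 = G s + (\<Sum>j<Suc k. d j / (s - a) ^ Suc j)"
      by (subst sum.lessThan_Suc_shift) (simp add: d_def)
    finally show ?thesis .
  qed
  ultimately show ?case by blast
qed

text \<open>The poles are split off one at a time; each step leaves a function that is holomorphic
  at the treated pole and no worse at the others.\<close>

lemma principal_parts:
  fixes f :: "complex \<Rightarrow> complex"
  assumes "finite Z" "open S" "Z \<subseteq> S" "f holomorphic_on S - Z"
    and "\<And>a. a \<in> Z \<Longrightarrow> (\<lambda>s. (s - a) ^ k a * f s) \<in> O[at a](\<lambda>_. 1)"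
  shows "\<exists>c H. H holomorphic_on S \<and>
           (\<forall>s\<in>S - Z. f s = H s + (\<Sum>a\<in>Z. \<Sum>j<k a. c a j / (s - a) ^ Suc j))"
  using assms(1,3-5)
proof (induction Z arbitrary: f rule: finite_induct)
  case empty
  thus ?case by auto
next
  case (insert a Z)
  have fZ: "closed Z" using insert by (simp add: finite_imp_closed)
  obtain c G where G: "G holomorphic_on S - Z"
      "\<And>s. s \<in> S - Z - {a} \<Longrightarrow> f s = G s + (\<Sum>j<k a. c j / (s - a) ^ Suc j)"
  proof -
    have "\<exists>c G. G holomorphic_on S - Z \<and>
        (\<forall>s\<in>S - Z - {a}. f s = G s + (\<Sum>j<k a. c j / (s - a) ^ Suc j))"
    proof (rule principal_part_at)
      show "open (S - Z)" using \<open>open S\<close> fZ by (rule open_Diff)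
      show "a \<in> S - Z" using insert by simp
      have "S - insert a Z = S - Z - {a}" by blast
      thus "f holomorphic_on S - Z - {a}" using insert.prems by simp
      show "(\<lambda>s. (s - a) ^ k a * f s) \<in> O[at a](\<lambda>_. 1)" using insert.prems by simp
    qed
    thus ?thesis using that by blast
  qed
  \<comment> \<open>Near \<open>b\<close> the functions \<open>f\<close> and \<open>G\<close> differ
    by the principal part at \<open>a\<close>, which has a finite limit at \<open>b\<close>; so the
    order bound at \<open>b\<close> passes to \<open>G\<close>.\<close>
  have "(\<lambda>s. (s - b) ^ k b * G s) \<in> O[at b](\<lambda>_. 1)" if b: "b \<in> Z" for b
  proof -
    have ab: "b \<noteq> a" using b insert.hyps by auto
    have "(\<lambda>s. (s - b) ^ k b * (\<Sum>j<k a. c j / (s - a) ^ Suc j))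
             \<midarrow>b\<rightarrow> (b - b) ^ k b * (\<Sum>j<k a. c j / (b - a) ^ Suc j)"
      using ab by (intro tendsto_intros) auto
    hence "(\<lambda>s. (s - b) ^ k b * (\<Sum>j<k a. c j / (s - a) ^ Suc j)) \<in> O[at b](\<lambda>_. 1)"
      by (intro bigoI_tendsto[where c = "(b - b) ^ k b * (\<Sum>j<k a. c j / (b - a) ^ Suc j)"]) auto
    from sum_in_bigo(2)[OF insert.prems(3)[of b] this] b
    have "(\<lambda>s. (s - b) ^ k b * f s - (s - b) ^ k b * (\<Sum>j<k a. c j / (s - a) ^ Suc j))
            \<in> O[at b](\<lambda>_. 1)" by simp
    moreover have "eventually (\<lambda>s. s \<in> (S - (Z - {b}) - {a}) - {b}) (at b)"
    proof (rule eventually_at_in_open)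
      show "open (S - (Z - {b}) - {a})"
        using \<open>open S\<close> insert.hyps by (intro open_Diff finite_imp_closed) simp_all
    qed (use b ab insert.prems in auto)
    hence "eventually (\<lambda>s. (s - b) ^ k b * f s - (s - b) ^ k b * (\<Sum>j<k a. c j / (s - a) ^ Suc j)
              = (s - b) ^ k b * G s) (at b)"
    proof eventually_elim
      case (elim s)
      hence "s \<in> S - Z - {a}" by auto
      from G(2)[OF this] show ?case by (simp add: algebra_simps)
    qed
    ultimately show ?thesis by (simp cong: landau_o.big.in_cong)
  qed
  then obtain d H where H: "H holomorphic_on S"
      "\<And>s. s \<in> S - Z \<Longrightarrow> G s = H s + (\<Sum>b\<in>Z. \<Sum>j<k b. d b j / (s - b) ^ Suc j)"
    using insert.IH[of G] insert.prems G(1) by blast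
  have "f s = H s + (\<Sum>b\<in>insert a Z. \<Sum>j<k b. (d(a := c)) b j / (s - b) ^ Suc j)"
    if "s \<in> S - insert a Z" for s
  proof -
    have "(\<Sum>b\<in>Z. \<Sum>j<k b. (d(a := c)) b j / (s - b) ^ Suc j)
            = (\<Sum>b\<in>Z. \<Sum>j<k b. d b j / (s - b) ^ Suc j)"
      using insert.hyps by (intro sum.cong) auto
    thus ?thesis using that G(2)[of s] H(2)[of s] insert.hyps by (simp add: add_ac)
  qed
  with H(1) show ?case by blast
qed

text \<open>Since \<open>s - a = (- a) * (1 - s / a)\<close>, this is the negative binomial series
  in \<open>s / a\<close>.\<close>

lemma pole_has_fps_expansion:
  fixes a :: complex
  assumes "a \<noteq> 0"
  shows "(\<lambda>s. 1 / (s - a) ^ Suc j) has_fps_expansion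
           (fps_const (1 / (- a) ^ Suc j) * Abs_fps (\<lambda>n. of_nat ((n + j) choose j) * (1 / a) ^ n))"
proof -
  have "(\<lambda>s. 1 / (- a) ^ Suc j * inverse ((1 - 1 / a * s) ^ Suc j)) has_fps_expansion
     (fps_const (1 / (- a) ^ Suc j) * inverse ((1 - fps_const (1 / a) * fps_X) ^ Suc j))"
    by (intro fps_expansion_intros) (auto simp: fps_nth_power_0)
  also have "inverse ((1 - fps_const (1 / a) * fps_X) ^ Suc j)
      = Abs_fps (\<lambda>n. of_nat ((n + j) choose j) * (1 / a) ^ n)"
  proof -
    have "(Suc j + n - 1) choose n = (n + j) choose j" for n
      using binomial_symmetric[of j "n + j"] by (simp add: add.commute)
    thus ?thesis by (simp only: one_minus_const_fps_X_neg_power'[OF zero_less_Suc])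
  qed
  also have "(\<lambda>s. 1 / (- a) ^ Suc j * inverse ((1 - 1 / a * s) ^ Suc j)) = (\<lambda>s. 1 / (s - a) ^ Suc j)"
  proof
    fix s
    have "s - a = (- a) * (1 - 1 / a * s)"
      using assms by (simp add: field_simps)
    hence "(s - a) ^ Suc j = ((- a) * (1 - 1 / a * s)) ^ Suc j" by simp
    thus "1 / (- a) ^ Suc j * inverse ((1 - 1 / a * s) ^ Suc j) = 1 / (s - a) ^ Suc j"
      by (simp only: power_mult_distrib) (simp add: divide_inverse)
  qed
  finally show ?thesis .
qed

text \<open>The radius beyond \<open>exp (- \<theta>)\<close> makes the coefficients of the
  holomorphic remainder summable against \<open>exp (- \<theta> * n)\<close>. Injectivity pairs each
  pole with one root, so the principal part at \<open>exp (- w)\<close> contributes to the term of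
  \<open>w\<close> alone.\<close>

theorem exp_poly_approx_meromorphic_conv:
  fixes u :: "complex fps" and f :: "nat \<Rightarrow> complex"
  assumes W: "finite W" "inj_on (\<lambda>w. exp (- w)) W" "\<And>w. w \<in> W \<Longrightarrow> Re w > \<theta>"
    and R: "exp (- \<theta>) < R"
    and U: "U holomorphic_on ball 0 R - (\<lambda>w. exp (- w)) ` W" "U has_fps_expansion u"
    and poles: "\<And>w. w \<in> W \<Longrightarrow> (\<lambda>s. (s - exp (- w)) ^ K w * U s) \<in> O[at (exp (- w))](\<lambda>_. 1)"
    and f: "\<And>m. norm (f m) \<le> C * exp (\<theta> * real m)"
  shows "exp_poly_approx W K \<theta> (\<lambda>n. \<Sum>m\<le>n. fps_nth u (n - m) * f m)"
proof -
  define e where "e w = exp (- w)" for w :: complex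
  define Z where "Z = e ` W"
  have inj: "inj_on e W" using W(2) by (simp add: e_def[abs_def])
  \<comment> \<open>Recovers the root from its pole, so that the order bound \<open>K\<close>,
    indexed by roots, can be read off at a pole.\<close>
  define L where "L = the_inv_into W e"
  have L: "L (e w) = w" if "w \<in> W" for w
    unfolding L_def by (rule the_inv_into_f_f[OF inj that])
  have norm_e: "norm (e w) < R" if "w \<in> W" for w
  proof -
    have "exp (- Re w) < exp (- \<theta>)" using W(3)[OF that] by simp
    thus ?thesis using R by (simp add: e_def norm_exp_eq_Re del: exp_less_cancel_iff)
  qed
  have Rpos: "R > 0" using R exp_gt_zero order.strict_trans by blast
  have "\<exists>c H. H holomorphic_on ball 0 R \<and>
      (\<forall>s\<in>ball 0 R - Z. U s = H s + (\<Sum>a\<in>Z. \<Sum>j<K (L a). c a j / (s - a) ^ Suc j))"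
  proof (rule principal_parts)
    show "finite Z" "Z \<subseteq> ball 0 R" using W norm_e by (auto simp: Z_def)
    show "U holomorphic_on ball 0 R - Z" using U by (simp add: Z_def e_def[abs_def])
    show "(\<lambda>s. (s - a) ^ K (L a) * U s) \<in> O[at a](\<lambda>_. 1)" if "a \<in> Z" for a
      using that poles L by (auto simp: Z_def e_def)
  qed auto
  then obtain c H where H: "H holomorphic_on ball 0 R"
      "\<And>s. s \<in> ball 0 R - Z \<Longrightarrow> U s = H s + (\<Sum>a\<in>Z. \<Sum>j<K (L a). c a j / (s - a) ^ Suc j)"
    by blast
  define h where "h = fps_expansion H 0"
  have "H holomorphic_on eball 0 (ereal R)" using H(1) by simp
  hence rad: "fps_conv_radius h \<ge> ereal R" unfolding h_def by (rule conv_radius_fps_expansion)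
  have h: "H has_fps_expansion h"
    unfolding h_def using H(1) Rpos
    by (intro analytic_at_imp_has_fps_expansion_0) (auto simp: analytic_at intro!: exI[of _ "ball 0 R"])
  \<comment> \<open>\<open>v w j\<close> is the series of the reciprocal of
    \<open>(1 - s / e w) ^ Suc j\<close>; the remaining constant goes into
    \<open>d w j\<close>.\<close>
  define v where "v w j = Abs_fps (\<lambda>n. of_nat ((n + j) choose j) * (1 / e w) ^ n)" for w j
  define d where "d w j = c (e w) j / (- e w) ^ Suc j" for w j
  have "(\<lambda>s. H s + (\<Sum>w\<in>W. \<Sum>j<K w. c (e w) j * (1 / (s - e w) ^ Suc j))) has_fps_expansion
      (h + (\<Sum>w\<in>W. \<Sum>j<K w. fps_const (c (e w) j) * (fps_const (1 / (- e w) ^ Suc j) * v w j)))"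
    unfolding v_def
    by (intro has_fps_expansion_add has_fps_expansion_sum has_fps_expansion_cmult_left
        pole_has_fps_expansion h) (auto simp: e_def)
  also have "(\<lambda>s. H s + (\<Sum>w\<in>W. \<Sum>j<K w. c (e w) j * (1 / (s - e w) ^ Suc j)))
     = (\<lambda>s. H s + (\<Sum>a\<in>Z. \<Sum>j<K (L a). c a j / (s - a) ^ Suc j))"
    unfolding Z_def sum.reindex[OF inj] by (intro ext) (simp add: L cong: sum.cong)
  finally have exp1: "\<dots> has_fps_expansion
     (h + (\<Sum>w\<in>W. \<Sum>j<K w. fps_const (c (e w) j) * (fps_const (1 / (- e w) ^ Suc j) * v w j)))" .
  \<comment> \<open>No pole is at 0 because \<open>exp\<close> never vanishes. So the decomposition
    holds near 0, and uniqueness of expansions turns it into an identity of power series.\<close>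
  have "eventually (\<lambda>s. s \<in> ball 0 R - Z) (nhds 0)"
    using Rpos W(1) by (intro eventually_nhds_in_open open_Diff finite_imp_closed)
       (auto simp: Z_def e_def)
  hence "eventually (\<lambda>s. U s = H s + (\<Sum>a\<in>Z. \<Sum>j<K (L a). c a j / (s - a) ^ Suc j)) (nhds 0)"
    by eventually_elim (use H(2) in auto)
  with U(2) have "(\<lambda>s. H s + (\<Sum>a\<in>Z. \<Sum>j<K (L a). c a j / (s - a) ^ Suc j)) has_fps_expansion u"
    by (subst (asm) has_fps_expansion_cong) auto
  with exp1 have u: "u = h + (\<Sum>w\<in>W. \<Sum>j<K w. fps_const (c (e w) j) * (fps_const (1 / (- e w) ^ Suc j) * v w j))"
    using fps_expansion_unique_complex by blast
  have u_nth: "fps_nth u n = fps_nth h n + (\<Sum>w\<in>W. \<Sum>j<K w. d w j * fps_nth (v w j) n)" for n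
    unfolding u by (simp add: fps_sum_nth d_def mult.assoc[symmetric])
  have conv_u: "(\<Sum>m\<le>n. fps_nth u (n - m) * f m) = (\<Sum>m\<le>n. fps_nth h (n - m) * f m) +
      (\<Sum>w\<in>W. \<Sum>j<K w. d w j * (\<Sum>m\<le>n. fps_nth (v w j) (n - m) * f m))" for n
  proof -
    have "(\<Sum>m\<le>n. (\<Sum>w\<in>W. \<Sum>j<K w. d w j * fps_nth (v w j) (n - m)) * f m)
        = (\<Sum>m\<le>n. \<Sum>w\<in>W. \<Sum>j<K w. d w j * (fps_nth (v w j) (n - m) * f m))"
      by (simp only: sum_distrib_right mult.assoc)
    also have "\<dots> = (\<Sum>w\<in>W. \<Sum>m\<le>n. \<Sum>j<K w. d w j * (fps_nth (v w j) (n - m) * f m))"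
      by (rule sum.swap)
    also have "\<dots> = (\<Sum>w\<in>W. \<Sum>j<K w. \<Sum>m\<le>n. d w j * (fps_nth (v w j) (n - m) * f m))"
      by (intro sum.cong refl sum.swap)
    also have "\<dots> = (\<Sum>w\<in>W. \<Sum>j<K w. d w j * (\<Sum>m\<le>n. fps_nth (v w j) (n - m) * f m))"
      by (simp only: sum_distrib_left)
    finally show ?thesis
      unfolding u_nth ring_distribs sum.distrib by simp
  qed
  \<comment> \<open>\<open>exp (- \<theta>)\<close> lies strictly inside the disc of convergence of
    \<open>h\<close>, where convergence is absolute.\<close>
  have "summable (\<lambda>n. norm (fps_nth h n * complex_of_real (exp (- \<theta>)) ^ n))"
    using R by (intro norm_summable_fps order.strict_trans2[OF _ rad]) auto
  hence sh: "summable (\<lambda>n. norm (fps_nth h n) * exp (- \<theta> * real n))"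
    by (simp add: norm_mult norm_power exp_of_nat_mult[symmetric] mult_ac)
  have "exp_poly_approx W K \<theta> (\<lambda>n. \<Sum>m\<le>n. fps_nth (v w j) (n - m) * f m)"
    if w: "w \<in> W" and j: "j < K w" for w j
  proof -
    obtain P :: "complex poly"
      where P: "degree P \<le> j" "\<And>n. poly P (of_nat n) = of_nat ((n + j) choose j)"
      using binomial_as_poly[of j] by blast
    have "(1 / e w) ^ n = exp (w * of_nat n)" for n
      by (simp add: e_def exp_minus exp_of_nat2_mult inverse_eq_divide)
    hence "fps_nth (v w j) n = exp (w * of_nat n) * poly P (of_nat n)" for n
      by (simp add: v_def P(2) mult_ac)
    thus ?thesis
      using exp_poly_approx_conv_poly[of W w P K \<theta> f C] w j P(1) W f by (simp add: mult_ac)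
  qed
  thus ?thesis
    unfolding conv_u
    by (intro exp_poly_approx_add[OF exp_poly_approx_bigo[OF conv_summable_bigo[OF sh f]]]
        exp_poly_approx_sum exp_poly_approx_cmult) auto
qed

section \<open>Laplace transforms of lattice measures\<close>

lemma lattice_measure_singleton_finite:
  assumes "lattice_measure M"
  shows "emeasure M {x} < \<infinity>"
  using assms unfolding lattice_measure_def by auto

lemma lattice_measure_sets:
  assumes "lattice_measure M"
  shows "sets M = sets borel" "space M = UNIV" "{x} \<in> sets M"
  using assms sets_eq_imp_space_eq[of M borel] by (auto simp: lattice_measure_def)

lemma AE_lattice_measure:
  assumes "lattice_measure M"
  shows "AE x in M. x \<in> \<nat>"
proof (rule AE_I)
  show "emeasure M (- \<nat>) = 0" using assms by (simp add: lattice_measure_def)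
  have "countable (\<nat> :: real set)" by (simp add: Nats_def)
  hence "\<nat> \<in> sets (borel :: real measure)" by (rule sets.countable[rotated]) auto
  thus "- \<nat> \<in> sets M" using lattice_measure_sets[OF assms] by simp
qed (auto simp: lattice_measure_sets[OF assms])

lemma sums_indicator_Nats:
  fixes g :: "nat \<Rightarrow> 'a :: real_normed_vector"
  shows "(\<lambda>n. indicator {real n} (real k) *\<^sub>R g n) sums g k"
proof -
  have "(\<lambda>n. if n = k then g n else 0) sums g k" by (rule sums_single)
  also have "(\<lambda>n. if n = k then g n else 0) = (\<lambda>n. indicator {real n} (real k) *\<^sub>R g n)"
    by (auto simp: indicator_def)
  finally show ?thesis .
qed

text \<open>Almost everywhere the integrand is the sum of its restrictions to the atoms, and sum and
  integral of nonnegative functions commute. Local finiteness makes each atom finite, so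
  \<open>measure\<close> agrees with \<open>emeasure\<close> on it.\<close>

lemma nn_integral_lattice_measure:
  assumes M: "lattice_measure M"
  shows "(\<integral>\<^sup>+x. ennreal (g x) \<partial>M) = (\<Sum>n. ennreal (g (real n)) * ennreal (measure M {real n}))"
proof -
  have "(\<integral>\<^sup>+x. ennreal (g x) \<partial>M)
          = (\<integral>\<^sup>+x. (\<Sum>n. ennreal (g (real n)) * indicator {real n} x) \<partial>M)"
  proof (rule nn_integral_cong_AE, use AE_lattice_measure[OF M] in eventually_elim)
    case (elim x)
    then obtain k where k: "x = real k" by (auto elim: Nats_cases)
    have "(\<Sum>n. ennreal (g (real n)) * indicator {real n} x)
            = (\<Sum>n. if n = k then ennreal (g x) else 0)"
      by (intro suminf_cong) (auto simp: k indicator_def)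
    also have "\<dots> = ennreal (g x)" using sums_single[of k "\<lambda>_. ennreal (g x)"] by (simp add: sums_iff)
    finally show ?case by simp
  qed
  also have "\<dots> = (\<Sum>n. \<integral>\<^sup>+x. ennreal (g (real n)) * indicator {real n} x \<partial>M)"
    by (rule nn_integral_suminf) (use lattice_measure_sets[OF M] in measurable)
  also have "\<dots> = (\<Sum>n. ennreal (g (real n)) * ennreal (measure M {real n}))"
    using lattice_measure_sets[OF M] lattice_measure_singleton_finite[OF M]
    by (simp add: nn_integral_cmult_indicator emeasure_eq_ennreal_measure less_top)
  finally show ?thesis .
qed

text \<open>The generating function of the masses; at \<open>exp (- z)\<close> it takes the value of
  the Laplace transform at \<open>z\<close>.\<close>

definition mass_fps :: "real measure \<Rightarrow> complex fps" where
  "mass_fps M = Abs_fps (\<lambda>n. complex_of_real (measure M {real n}))"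

lemma laplace_integral_finite_iff:
  assumes M: "lattice_measure M"
  shows "(\<integral>\<^sup>+x. ennreal (exp (- r * x)) \<partial>M) < \<infinity> \<longleftrightarrow>
           summable (\<lambda>n. measure M {real n} * exp (- r) ^ n)"
proof -
  have "(\<integral>\<^sup>+x. ennreal (exp (- r * x)) \<partial>M)
          = (\<Sum>n. ennreal (measure M {real n} * exp (- r) ^ n))"
    unfolding nn_integral_lattice_measure[OF M]
  proof (rule suminf_cong)
    fix n
    have "exp (- r * real n) = exp (- r) ^ n"
      using exp_of_nat_mult[of n "- r"] by (simp only: mult.commute)
    thus "ennreal (exp (- r * real n)) * ennreal (measure M {real n})
            = ennreal (measure M {real n} * exp (- r) ^ n)"
      by (simp add: ennreal_mult mult.commute)
  qed
  also have "\<dots> < \<infinity> \<longleftrightarrow> summable (\<lambda>n. measure M {real n} * exp (- r) ^ n)"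
  proof
    assume "(\<Sum>n. ennreal (measure M {real n} * exp (- r) ^ n)) < \<infinity>"
    thus "summable (\<lambda>n. measure M {real n} * exp (- r) ^ n)"
      by (intro summable_suminf_not_top) (auto simp: less_top)
  next
    assume "summable (\<lambda>n. measure M {real n} * exp (- r) ^ n)"
    hence "(\<Sum>n. ennreal (measure M {real n} * exp (- r) ^ n)) \<noteq> \<infinity>"
      unfolding infinity_ennreal_def by (intro ennreal_suminf_neq_top) auto
    thus "(\<Sum>n. ennreal (measure M {real n} * exp (- r) ^ n)) < \<infinity>"
      by (simp add: less_top)
  qed
  finally show ?thesis .
qed

text \<open>Because \<open>exp (- z) ^ n\<close> has norm \<open>exp (- Re z) ^ n\<close>, the
  summability hypothesis is the absolute convergence that permits exchanging the integral with the
  sum over atoms.\<close>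

lemma laplace_integral_eq_eval_fps:
  assumes M: "lattice_measure M"
    and s: "summable (\<lambda>n. measure M {real n} * exp (- Re z) ^ n)"
  shows "(LINT x:{0..}|M. exp (- z * complex_of_real x)) = eval_fps (mass_fps M) (exp (- z))"
proof -
  note sets = lattice_measure_sets[OF M]
  define g where "g n x = indicator {real n} x *\<^sub>R exp (- z) ^ n" for n :: nat and x :: real
  have ind: "integrable M (indicat_real {real n})" for n
    using sets lattice_measure_singleton_finite[OF M] by (intro integrable_real_indicator)
  have int: "integrable M (g n)" for n
    unfolding g_def by (intro integrable_scaleR_left ind)
  have g: "integral\<^sup>L M (g n) = measure M {real n} *\<^sub>R exp (- z) ^ n" for n
  proof -
    have "integral\<^sup>L M (g n) = integral\<^sup>L M (indicat_real {real n}) *\<^sub>R exp (- z) ^ n"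
      unfolding g_def by (rule integral_scaleR_left[OF ind])
    thus ?thesis using sets by simp
  qed
  have norm_g: "norm (g n x) = indicator {real n} x *\<^sub>R exp (- Re z) ^ n" for n x
    by (simp add: g_def norm_power norm_exp_eq_Re)
  have ng: "(\<integral>x. norm (g n x) \<partial>M) = measure M {real n} * exp (- Re z) ^ n" for n
  proof -
    have "(\<integral>x. norm (g n x) \<partial>M) = integral\<^sup>L M (indicat_real {real n}) *\<^sub>R exp (- Re z) ^ n"
      unfolding norm_g by (rule integral_scaleR_left[OF ind])
    thus ?thesis using sets by simp
  qed
  have "AE x in M. summable (\<lambda>n. norm (g n x))"
    using AE_lattice_measure[OF M]
  proof eventually_elim
    case (elim x)
    then obtain k where "x = real k" by (auto elim: Nats_cases)
    thus ?case unfolding norm_g using sums_indicator_Nats[of k "\<lambda>n. exp (- Re z) ^ n"]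
      by (simp add: sums_iff)
  qed
  from integral_suminf[OF int this] s
  have "(\<integral>x. (\<Sum>n. g n x) \<partial>M) = (\<Sum>n. measure M {real n} *\<^sub>R exp (- z) ^ n)"
    by (simp add: ng g)
  also have "(\<integral>x. (\<Sum>n. g n x) \<partial>M) = (LINT x:{0..}|M. exp (- z * complex_of_real x))"
    unfolding set_lebesgue_integral_def
  proof (rule integral_cong_AE)
    show "(\<lambda>x. \<Sum>n. g n x) \<in> borel_measurable M"
      using int by (intro borel_measurable_suminf borel_measurable_integrable)
    have "(\<lambda>x. indicator {0..} x *\<^sub>R exp (- z * complex_of_real x)) \<in> borel_measurable borel"
      by measurable
    thus "(\<lambda>x. indicat_real {0..} x *\<^sub>R exp (- z * complex_of_real x)) \<in> borel_measurable M"
      using sets measurable_cong_sets[of M borel borel borel] by simp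
    show "AE x in M. (\<Sum>n. g n x) = indicat_real {0..} x *\<^sub>R exp (- z * complex_of_real x)"
      using AE_lattice_measure[OF M]
    proof eventually_elim
      case (elim x)
      then obtain k where k: "x = real k" by (auto elim: Nats_cases)
      show ?case unfolding g_def k using sums_indicator_Nats[of k "\<lambda>n. exp (- z) ^ n"]
        by (simp add: sums_iff exp_of_nat_mult[symmetric] mult_ac)
    qed
  qed
  finally show ?thesis
    by (simp add: eval_fps_def mass_fps_def scaleR_conv_of_real)
qed

lemma laplace_dom_iff:
  assumes "\<forall>i<p. \<forall>j<p. lattice_measure (\<mu> i j)"
  shows "z \<in> laplace_dom p \<mu> \<longleftrightarrow>
     (\<forall>i<p. \<forall>j<p. summable (\<lambda>n. measure (\<mu> i j) {real n} * exp (- Re z) ^ n))"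
proof -
  have "(\<integral>\<^sup>+x. ennreal (exp (- Re z * x)) \<partial>\<mu> i j) < \<infinity> \<longleftrightarrow>
          summable (\<lambda>n. measure (\<mu> i j) {real n} * exp (- Re z) ^ n)" if "i < p" "j < p" for i j
    using assms that by (intro laplace_integral_finite_iff) blast
  thus ?thesis unfolding laplace_dom_def by blast
qed

text \<open>All mass sits at nonnegative points, so increasing the real part shrinks every term of
  the series.\<close>

lemma laplace_dom_mono:
  assumes \<mu>: "\<forall>i<p. \<forall>j<p. lattice_measure (\<mu> i j)"
    and "w \<in> laplace_dom p \<mu>" "Re w \<le> Re z"
  shows "z \<in> laplace_dom p \<mu>"
  unfolding laplace_dom_iff[OF \<mu>]
proof (intro allI impI)
  fix i j assume "i < p" "j < p"
  hence "summable (\<lambda>n. measure (\<mu> i j) {real n} * exp (- Re w) ^ n)"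
    using assms(2) by (simp add: laplace_dom_iff[OF \<mu>])
  thus "summable (\<lambda>n. measure (\<mu> i j) {real n} * exp (- Re z) ^ n)"
  proof (rule summable_comparison_test')
    show "norm (measure (\<mu> i j) {real n} * exp (- Re z) ^ n)
            \<le> measure (\<mu> i j) {real n} * exp (- Re w) ^ n" for n
      using assms(3) by (simp add: mult_left_mono power_mono)
  qed
qed

section \<open>The matrix of the renewal equation in the variable
  \<open>s = exp (- z)\<close>\<close>

definition renewal_fps_mat :: "nat \<Rightarrow> (nat \<Rightarrow> nat \<Rightarrow> real measure) \<Rightarrow> complex fps mat" where
  "renewal_fps_mat p \<mu> = mat p p (\<lambda>(i, j). of_bool (i = j) - mass_fps (\<mu> i j))"

text \<open>The analytic counterpart of \<open>renewal_fps_mat\<close>: the equation is solved over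
  formal series, zeros and poles are studied on this function, and expansion at 0 connects the
  two.\<close>

definition renewal_mat :: "nat \<Rightarrow> (nat \<Rightarrow> nat \<Rightarrow> real measure) \<Rightarrow> complex \<Rightarrow> complex mat" where
  "renewal_mat p \<mu> s = mat p p (\<lambda>(i, j). of_bool (i = j) - eval_fps (mass_fps (\<mu> i j)) s)"

lemma renewal_mat_carrier [simp]:
  "renewal_fps_mat p \<mu> \<in> carrier_mat p p" "renewal_mat p \<mu> s \<in> carrier_mat p p"
  by (simp_all add: renewal_fps_mat_def renewal_mat_def)

lemma laplace_mat_eq:
  assumes \<mu>: "\<forall>i<p. \<forall>j<p. lattice_measure (\<mu> i j)" and z: "z \<in> laplace_dom p \<mu>"
  shows "1\<^sub>m p - laplace_mat p \<mu> z = renewal_mat p \<mu> (exp (- z))"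
proof -
  have "(LINT x:{0..}|\<mu> i j. exp (- z * complex_of_real x)) = eval_fps (mass_fps (\<mu> i j)) (exp (- z))"
    if "i < p" "j < p" for i j
    using \<mu> z that unfolding laplace_dom_iff[OF \<mu>] by (intro laplace_integral_eq_eval_fps) blast+
  thus ?thesis
    by (intro eq_matI) (auto simp: laplace_mat_def renewal_mat_def)
qed

lemma conv_radius_mass_fps:
  assumes \<mu>: "\<forall>i<p. \<forall>j<p. lattice_measure (\<mu> i j)"
    and "complex_of_real r \<in> laplace_dom p \<mu>" "i < p" "j < p"
  shows "fps_conv_radius (mass_fps (\<mu> i j)) \<ge> ereal (exp (- r))"
proof -
  have "summable (\<lambda>n. measure (\<mu> i j) {real n} * exp (- r) ^ n)"
    using assms by (simp add: laplace_dom_iff[OF \<mu>])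
  hence "summable (\<lambda>n. complex_of_real (measure (\<mu> i j) {real n} * exp (- r) ^ n))"
    by (rule summable_of_real)
  hence "summable (\<lambda>n. fps_nth (mass_fps (\<mu> i j)) n * complex_of_real (exp (- r)) ^ n)"
    by (simp add: mass_fps_def)
  from conv_radius_geI[OF this] show ?thesis by (simp add: fps_conv_radius_def)
qed

section \<open>Determinants, adjugates and the renewal equation\<close>

text \<open>By the Leibniz formula the determinant is a polynomial in the entries, and expansions
  respect sums and products.\<close>

lemma has_fps_expansion_det:
  fixes B :: "complex fps mat" and A :: "complex \<Rightarrow> complex mat"
  assumes B: "B \<in> carrier_mat n n" and A: "\<And>s. A s \<in> carrier_mat n n"
    and "\<And>i j. i < n \<Longrightarrow> j < n \<Longrightarrow> (\<lambda>s. A s $$ (i, j)) has_fps_expansion B $$ (i, j)"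
  shows "(\<lambda>s. Determinant.det (A s)) has_fps_expansion Determinant.det B"
proof -
  have sgn: "(\<lambda>_. of_int (sign q) :: complex) has_fps_expansion of_int (sign q)" for q :: "nat \<Rightarrow> nat"
    by (cases q rule: sign_cases) (auto intro!: has_fps_expansion_minus)
  have dims: "dim_row B = n" "dim_col B = n" "dim_row (A s) = n" "dim_col (A s) = n" for s
    using B A[of s] by auto
  show ?thesis
    unfolding Determinant.det_def dims if_True simp_thms
    by (intro has_fps_expansion_sum has_fps_expansion_mult has_fps_expansion_prod sgn assms)
       (auto simp: permutes_in_image)
qed

lemma holomorphic_on_det:
  fixes A :: "complex \<Rightarrow> complex mat"
  assumes A: "\<And>s. A s \<in> carrier_mat n n"
    and "\<And>i j. i < n \<Longrightarrow> j < n \<Longrightarrow> (\<lambda>s. A s $$ (i, j)) holomorphic_on S"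
  shows "(\<lambda>s. Determinant.det (A s)) holomorphic_on S"
proof -
  have dims: "dim_row (A s) = n" "dim_col (A s) = n" for s
    using A[of s] by auto
  show ?thesis
    unfolding Determinant.det_def dims if_True simp_thms
    by (intro holomorphic_intros assms) (auto simp: permutes_in_image)
qed

lemma adj_mat_index:
  assumes "A \<in> carrier_mat n n" "i < n" "j < n"
  shows "adj_mat A $$ (i, j) = (- 1) ^ (j + i) * Determinant.det (mat_delete A j i)"
  using assms by (simp add: adj_mat_def cofactor_def)

lemma mat_delete_entry:
  assumes "A \<in> carrier_mat n n" "i < n - 1" "j < n - 1"
  shows "mat_delete A k l $$ (i, j) = A $$ (if i < k then i else Suc i, if j < l then j else Suc j)"
  using assms by (simp add: mat_delete_def)

lemma has_fps_expansion_adj_mat: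
  fixes B :: "complex fps mat" and A :: "complex \<Rightarrow> complex mat"
  assumes B: "B \<in> carrier_mat n n" and A: "\<And>s. A s \<in> carrier_mat n n"
    and AB: "\<And>i j. i < n \<Longrightarrow> j < n \<Longrightarrow> (\<lambda>s. A s $$ (i, j)) has_fps_expansion B $$ (i, j)"
    and ij: "i < n" "j < n"
  shows "(\<lambda>s. adj_mat (A s) $$ (i, j)) has_fps_expansion adj_mat B $$ (i, j)"
proof -
  have "(\<lambda>s. Determinant.det (mat_delete (A s) j i)) has_fps_expansion Determinant.det (mat_delete B j i)"
  proof (rule has_fps_expansion_det)
    show "mat_delete B j i \<in> carrier_mat (n - 1) (n - 1)"
      "mat_delete (A s) j i \<in> carrier_mat (n - 1) (n - 1)" for s
      using mat_delete_carrier[OF B] mat_delete_carrier[OF A[of s]] by auto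
    show "(\<lambda>s. mat_delete (A s) j i $$ (k, l)) has_fps_expansion mat_delete B j i $$ (k, l)"
      if "k < n - 1" "l < n - 1" for k l
      unfolding mat_delete_entry[OF B that] mat_delete_entry[OF A that]
      using that by (intro AB) auto
  qed
  thus ?thesis
    unfolding adj_mat_index[OF B ij] adj_mat_index[OF A ij]
    by (intro has_fps_expansion_mult has_fps_expansion_power has_fps_expansion_minus has_fps_expansion_1)
qed

lemma holomorphic_on_adj_mat:
  fixes A :: "complex \<Rightarrow> complex mat"
  assumes A: "\<And>s. A s \<in> carrier_mat n n"
    and hol: "\<And>i j. i < n \<Longrightarrow> j < n \<Longrightarrow> (\<lambda>s. A s $$ (i, j)) holomorphic_on S"
    and ij: "i < n" "j < n"
  shows "(\<lambda>s. adj_mat (A s) $$ (i, j)) holomorphic_on S"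
proof -
  have "(\<lambda>s. Determinant.det (mat_delete (A s) j i)) holomorphic_on S"
  proof (rule holomorphic_on_det)
    show "mat_delete (A s) j i \<in> carrier_mat (n - 1) (n - 1)" for s
      using mat_delete_carrier[OF A[of s]] by auto
    show "(\<lambda>s. mat_delete (A s) j i $$ (k, l)) holomorphic_on S"
      if "k < n - 1" "l < n - 1" for k l
      unfolding mat_delete_entry[OF A that] using that by (intro hol) auto
  qed
  thus ?thesis
    unfolding adj_mat_index[OF A ij] by (intro holomorphic_intros)
qed

section \<open>Inversion by the adjugate\<close>

lemma mat_inverse_exists:
  fixes A :: "'a :: field mat"
  assumes "A \<in> carrier_mat n n" "Determinant.det A \<noteq> 0"
  shows "\<exists>R. mat_inverse A = Some R"
  using mat_inverse(1)[OF assms(1), of undefined] det_non_zero_imp_unit[OF assms, of undefined]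
  by blast

text \<open>Multiply \<open>A * R = 1\<close> by the adjugate from the left; the same equation shows
  that the determinant is nonzero. This makes the entries of the inverse quotients of holomorphic
  functions.\<close>

lemma mat_inverse_index:
  fixes A :: "'a :: field mat"
  assumes A: "A \<in> carrier_mat n n" and R: "mat_inverse A = Some R" and ij: "i < n" "j < n"
  shows "R $$ (i, j) = adj_mat A $$ (i, j) / Determinant.det A"
proof -
  have AR: "A * R = 1\<^sub>m n" and Rc: "R \<in> carrier_mat n n" using mat_inverse(2)[OF A R] by auto
  have adj: "adj_mat A \<in> carrier_mat n n" using adj_mat[OF A] by blast
  have "Determinant.det A * Determinant.det R = 1"
    using det_mult[OF A Rc] by (simp add: AR)
  hence det: "Determinant.det A \<noteq> 0" by auto
  have "adj_mat A = adj_mat A * (A * R)" using AR adj by simp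
  also have "\<dots> = adj_mat A * A * R" using Rc A adj by (simp add: assoc_mult_mat[of _ n n _ n _ n])
  also have "\<dots> = Determinant.det A \<cdot>\<^sub>m R"
    using Rc by (simp add: adj_mat(3)[OF A] mult_smult_assoc_mat[of _ n n _ n])
  finally have "adj_mat A $$ (i, j) = (Determinant.det A \<cdot>\<^sub>m R) $$ (i, j)" by simp
  with ij Rc det show ?thesis by simp
qed

text \<open>Cramer's rule with a determinant that is only a unit, with inverse \<open>d\<close>, so
  that it covers formal power series. The two directions use the two products of a matrix with its
  adjugate.\<close>

lemma det_inverse_solution:
  fixes B :: "'a :: idom mat"
  assumes B: "B \<in> carrier_mat n n" and d: "d * Determinant.det B = 1"
  shows "(\<forall>i<n. (\<Sum>j<n. B $$ (i, j) * x j) = y i) \<longleftrightarrow>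
         (\<forall>i<n. x i = (\<Sum>j<n. d * adj_mat B $$ (i, j) * y j))"
proof -
  have adj: "adj_mat B \<in> carrier_mat n n" using adj_mat[OF B] by blast
  have delta: "(\<Sum>j<n. (d * (Determinant.det B \<cdot>\<^sub>m 1\<^sub>m n) $$ (i, j)) * z j) = z i"
    if "i < n" for i and z :: "nat \<Rightarrow> 'a"
  proof -
    have "(\<Sum>j<n. (d * (Determinant.det B \<cdot>\<^sub>m 1\<^sub>m n) $$ (i, j)) * z j)
            = (\<Sum>j<n. if j = i then z j else 0)"
      using that d by (intro sum.cong) (auto simp: mult.assoc[symmetric])
    also have "\<dots> = z i" using that by simp
    finally show ?thesis .
  qed
  have prod: "(\<Sum>j<n. P $$ (i, j) * (\<Sum>k<n. Q $$ (j, k) * z k)) = (\<Sum>k<n. (P * Q) $$ (i, k) * z k)"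
    if "P \<in> carrier_mat n n" "Q \<in> carrier_mat n n" "i < n" for P Q i and z :: "nat \<Rightarrow> 'a"
  proof -
    have "(P * Q) $$ (i, k) = (\<Sum>j<n. P $$ (i, j) * Q $$ (j, k))" if "k < n" for k
      using \<open>P \<in> _\<close> \<open>Q \<in> _\<close> \<open>i < n\<close> that by (auto simp: scalar_prod_def atLeast0LessThan)
    hence "(\<Sum>k<n. (P * Q) $$ (i, k) * z k) = (\<Sum>k<n. \<Sum>j<n. P $$ (i, j) * Q $$ (j, k) * z k)"
      by (simp add: sum_distrib_right)
    also have "\<dots> = (\<Sum>j<n. \<Sum>k<n. P $$ (i, j) * Q $$ (j, k) * z k)" by (rule sum.swap)
    finally show ?thesis by (simp add: sum_distrib_left mult.assoc)
  qed
  show ?thesis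
  proof safe
    fix i assume i: "i < n" and eq: "\<forall>i<n. (\<Sum>j<n. B $$ (i, j) * x j) = y i"
    have "(\<Sum>j<n. d * adj_mat B $$ (i, j) * y j)
            = d * (\<Sum>j<n. adj_mat B $$ (i, j) * (\<Sum>k<n. B $$ (j, k) * x k))"
      using eq by (simp add: sum_distrib_left mult.assoc)
    also have "\<dots> = (\<Sum>k<n. (d * (Determinant.det B \<cdot>\<^sub>m 1\<^sub>m n) $$ (i, k)) * x k)"
      unfolding prod[OF adj B i] adj_mat(3)[OF B] by (simp add: sum_distrib_left mult.assoc)
    also have "\<dots> = x i" by (rule delta[OF i])
    finally show "x i = (\<Sum>j<n. d * adj_mat B $$ (i, j) * y j)" ..
  next
    fix i assume i: "i < n" and eq: "\<forall>i<n. x i = (\<Sum>j<n. d * adj_mat B $$ (i, j) * y j)"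
    have "(\<Sum>j<n. B $$ (i, j) * x j) = d * (\<Sum>j<n. B $$ (i, j) * (\<Sum>k<n. adj_mat B $$ (j, k) * y k))"
      using eq by (simp add: sum_distrib_left mult.assoc mult.left_commute)
    also have "\<dots> = (\<Sum>k<n. (d * (Determinant.det B \<cdot>\<^sub>m 1\<^sub>m n) $$ (i, k)) * y k)"
      unfolding prod[OF B adj i] adj_mat(2)[OF B] by (simp add: sum_distrib_left mult.assoc)
    also have "\<dots> = y i" by (rule delta[OF i])
    finally show "(\<Sum>j<n. B $$ (i, j) * x j) = y i" .
  qed
qed

text \<open>A vanishing determinant would make 1 an eigenvalue, which the spectral radius
  excludes.\<close>

lemma det_one_minus_ne_0:
  fixes M :: "complex mat"
  assumes M: "M \<in> carrier_mat n n" and n: "n > 0" and "spectral_radius M < 1"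
  shows "Determinant.det (1\<^sub>m n - M) \<noteq> 0"
proof
  assume "Determinant.det (1\<^sub>m n - M) = 0"
  moreover have "1\<^sub>m n - M = (- 1) \<cdot>\<^sub>m char_matrix M 1"
    using M by (intro eq_matI) (auto simp: char_matrix_def)
  ultimately have "Determinant.det (char_matrix M 1) = 0"
    by simp
  hence "eigenvalue M 1" by (simp add: eigenvalue_det[OF M])
  hence "norm (1 :: complex) \<in> norm ` spectrum M" by (simp only: spectrum_def mem_Collect_eq image_eqI)
  from spectral_radius_mem_max(2)[OF M n this] assms(3) show False by simp
qed

section \<open>The renewal equation over formal power series\<close>

lemma mass_fps_has_fps_expansion:
  assumes "fps_conv_radius (mass_fps M) > 0"
  shows "(\<lambda>s. eval_fps (mass_fps M) s) has_fps_expansion mass_fps M"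
  using assms by (simp add: has_fps_expansion_def)

lemma renewal_mat_has_fps_expansion:
  assumes "\<And>i j. i < p \<Longrightarrow> j < p \<Longrightarrow> fps_conv_radius (mass_fps (\<mu> i j)) > 0" "i < p" "j < p"
  shows "(\<lambda>s. renewal_mat p \<mu> s $$ (i, j)) has_fps_expansion renewal_fps_mat p \<mu> $$ (i, j)"
proof -
  have "(\<lambda>_. of_bool (i = j) :: complex) has_fps_expansion of_bool (i = j)" by auto
  thus ?thesis using assms
    by (simp add: renewal_mat_def renewal_fps_mat_def has_fps_expansion_diff mass_fps_has_fps_expansion)
qed

lemma renewal_mat_0: 
  "renewal_mat p \<mu> 0 = 1\<^sub>m p - map_mat complex_of_real (mass_mat p \<mu> 0)"
  by (intro eq_matI) (auto simp: renewal_mat_def mass_mat_def eval_fps_at_0 mass_fps_def)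

text \<open>The Cauchy product of power series is discrete convolution, so applying the matrix to
  generating functions subtracts the convolution with \<mu>.\<close>

lemma renewal_fps_mat_mult_nth:
  assumes "i < p"
  shows "fps_nth (\<Sum>j<p. renewal_fps_mat p \<mu> $$ (i, j) * g j) n =
     fps_nth (g i) n - (\<Sum>j<p. \<Sum>m\<le>n. complex_of_real (measure (\<mu> i j) {real m}) * fps_nth (g j) (n - m))"
proof -
  have "(\<Sum>j<p. renewal_fps_mat p \<mu> $$ (i, j) * g j)
          = (\<Sum>j<p. (if j = i then g j else 0) - mass_fps (\<mu> i j) * g j)"
    using assms by (intro sum.cong) (auto simp: renewal_fps_mat_def algebra_simps)
  also have "\<dots> = g i - (\<Sum>j<p. mass_fps (\<mu> i j) * g j)"
    using assms by (simp add: sum_subtractf)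
  finally show ?thesis
    by (simp add: fps_sum_nth fps_mult_nth mass_fps_def atLeast0AtMost)
qed

lemma disc_conv_index:
  assumes "i < p"
  shows "disc_conv p \<mu> F n $ i = (\<Sum>j<p. \<Sum>m\<le>n. measure (\<mu> i j) {real m} * F (n - m) $ j)"
  using assms by (simp add: disc_conv_def mass_mat_def)

lemma markov_renewal_solution_iff:
  assumes f: "\<forall>n. f n \<in> carrier_vec p"
  shows "markov_renewal_solution p \<mu> f F \<longleftrightarrow> (\<forall>n. F n \<in> carrier_vec p) \<and>
     (\<forall>i<p. \<forall>n. F n $ i = f n $ i + (\<Sum>j<p. \<Sum>m\<le>n. measure (\<mu> i j) {real m} * F (n - m) $ j))"
proof -
  have bdd: "locally_bounded_seq p F"
    unfolding locally_bounded_seq_def by (auto intro!: finite_imp_bounded)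
  have dim: "dim_vec (disc_conv p \<mu> F n) = p" for n by (simp add: disc_conv_def)
  have "F n = f n + disc_conv p \<mu> F n \<longleftrightarrow> (\<forall>i<p. F n $ i = f n $ i + 
      (\<Sum>j<p. \<Sum>m\<le>n. measure (\<mu> i j) {real m} * F (n - m) $ j))"
    if "F n \<in> carrier_vec p" for n
    unfolding vec_eq_iff using that f dim by (auto simp: disc_conv_index)
  thus ?thesis unfolding markov_renewal_solution_def using bdd by blast
qed

text \<open>Generating functions turn the equation into a linear system whose determinant is a unit,
  as its constant coefficient is nonzero. Cramer's rule then gives existence, uniqueness and the
  explicit formula together.\<close>

lemma markov_renewal_solution_exists_unique:
  assumes f: "\<forall>n. f n \<in> carrier_vec p"
    and det: "fps_nth (Determinant.det (renewal_fps_mat p \<mu>)) 0 \<noteq> 0"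
  shows "\<exists>F. markov_renewal_solution p \<mu> f F \<and> (\<forall>G. markov_renewal_solution p \<mu> f G \<longrightarrow> G = F) \<and>
     (\<forall>i<p. \<forall>n. complex_of_real (F n $ i) = (\<Sum>j<p. \<Sum>m\<le>n.
        fps_nth (adj_mat (renewal_fps_mat p \<mu>) $$ (i, j) / Determinant.det (renewal_fps_mat p \<mu>)) (n - m)
          * complex_of_real (f m $ j)))"
proof -
  define B where "B = renewal_fps_mat p \<mu>"
  define d where "d = inverse (Determinant.det B)"
  define y where "y i = Abs_fps (\<lambda>n. complex_of_real (f n $ i))" for i
  define x where "x i = (\<Sum>j<p. d * adj_mat B $$ (i, j) * y j)" for i
  have B: "B \<in> carrier_mat p p" by (simp add: B_def)
  have d: "d * Determinant.det B = 1"
    unfolding d_def using det by (intro inverse_mult_eq_1) (simp add: B_def)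
  have x_nth: "fps_nth (x i) n = (\<Sum>j<p. \<Sum>m\<le>n.
        fps_nth (adj_mat B $$ (i, j) / Determinant.det B) (n - m) * complex_of_real (f m $ j))" for i n
  proof -
    have "d * adj_mat B $$ (i, j) = adj_mat B $$ (i, j) / Determinant.det B" for j
      unfolding d_def using det by (subst fps_divide_unit) (simp_all add: B_def mult.commute)
    moreover have "fps_nth (u * y j) n = (\<Sum>m\<le>n. fps_nth u (n - m) * complex_of_real (f m $ j))" for u j
    proof -
      have "fps_nth (u * y j) n = fps_nth (y j * u) n" by (simp only: mult.commute)
      also have "\<dots> = (\<Sum>m\<le>n. fps_nth u (n - m) * complex_of_real (f m $ j))"
        unfolding fps_mult_nth by (simp add: y_def atLeast0AtMost mult.commute)
      finally show ?thesis .
    qed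
    ultimately show ?thesis by (simp add: x_def fps_sum_nth)
  qed
  have eqx: "(\<forall>i<p. (\<Sum>j<p. B $$ (i, j) * g j) = y i) \<longleftrightarrow> (\<forall>i<p. g i = x i)" for g
    unfolding x_def by (rule det_inverse_solution[OF B d])
  have eq_nth: "(\<Sum>j<p. B $$ (i, j) * g j) = y i \<longleftrightarrow> (\<forall>n. fps_nth (g i) n = complex_of_real (f n $ i) +
      (\<Sum>j<p. \<Sum>m\<le>n. complex_of_real (measure (\<mu> i j) {real m}) * fps_nth (g j) (n - m)))"
    if "i < p" for i g
    unfolding fps_eq_iff B_def renewal_fps_mat_mult_nth[OF that]
    by (auto simp: y_def algebra_simps)
  have sol_x: "complex_of_real (G n $ i) = fps_nth (x i) n"
    if G: "markov_renewal_solution p \<mu> f G" and i: "i < p"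
    for G :: "nat \<Rightarrow> real Matrix.vec" and n i
  proof -
    define g where "g i = Abs_fps (\<lambda>n. complex_of_real (G n $ i))" for i
    have "(\<Sum>j<p. B $$ (i, j) * g j) = y i" if i: "i < p" for i
      unfolding eq_nth[OF i]
    proof
      fix n
      have "G n $ i = f n $ i + (\<Sum>j<p. \<Sum>m\<le>n. measure (\<mu> i j) {real m} * G (n - m) $ j)"
        using G i unfolding markov_renewal_solution_iff[OF f] by blast
      from arg_cong[OF this, of complex_of_real]
      show "fps_nth (g i) n = complex_of_real (f n $ i) +
         (\<Sum>j<p. \<Sum>m\<le>n. complex_of_real (measure (\<mu> i j) {real m}) * fps_nth (g j) (n - m))"
        by (simp add: g_def)
    qed
    with eqx have "g i = x i" using i by blast
    thus ?thesis by (simp add: g_def fps_eq_iff)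
  qed
  \<comment> \<open>The system is solved over complex series. Masses and \<open>f\<close> are real,
    so the real parts solve the equation as well; uniqueness, applied to \<open>F\<close>, then
    shows that the coefficients of \<open>x\<close> are real.\<close>
  define F where "F n = Matrix.vec p (\<lambda>i. Re (fps_nth (x i) n))" for n
  have F: "markov_renewal_solution p \<mu> f F"
    unfolding markov_renewal_solution_iff[OF f]
  proof (intro conjI allI impI)
    fix i n assume i: "i < p"
    have "(\<Sum>j<p. B $$ (i, j) * x j) = y i" using eqx i by blast
    hence "fps_nth (x i) n = complex_of_real (f n $ i) +
      (\<Sum>j<p. \<Sum>m\<le>n. complex_of_real (measure (\<mu> i j) {real m}) * fps_nth (x j) (n - m))"
      unfolding eq_nth[OF i] by blast
    from arg_cong[OF this, of Re] i
    show "F n $ i = f n $ i + (\<Sum>j<p. \<Sum>m\<le>n. measure (\<mu> i j) {real m} * F (n - m) $ j)"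
      by (simp add: F_def)
  qed (simp add: F_def)
  have "G = F" if G: "markov_renewal_solution p \<mu> f G"
    for G :: "nat \<Rightarrow> real Matrix.vec"
  proof
    fix n
    have "G n $ i = F n $ i" if "i < p" for i
      using sol_x[OF G that, of n] sol_x[OF F that, of n] by (metis of_real_eq_iff)
    moreover have "G n \<in> carrier_vec p" "F n \<in> carrier_vec p"
      using G F unfolding markov_renewal_solution_def by blast+
    ultimately show "G n = F n" by (intro eq_vecI) auto
  qed
  with F show ?thesis using sol_x[OF F] unfolding x_nth B_def by blast
qed

section \<open>Pole orders of the resolvent\<close>

lemma renewal_mat_holomorphic:
  assumes "\<And>i j. i < p \<Longrightarrow> j < p \<Longrightarrow> fps_conv_radius (mass_fps (\<mu> i j)) \<ge> ereal R" "i < p" "j < p"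
  shows "(\<lambda>s. renewal_mat p \<mu> s $$ (i, j)) holomorphic_on ball 0 R"
proof -
  have "ball (0 :: complex) R \<subseteq> eball 0 (fps_conv_radius (mass_fps (\<mu> i j)))"
  proof
    fix s :: complex assume "s \<in> ball 0 R"
    hence "ereal (norm s) < ereal R" by simp
    also have "\<dots> \<le> fps_conv_radius (mass_fps (\<mu> i j))" using assms by blast
    finally show "s \<in> eball 0 (fps_conv_radius (mass_fps (\<mu> i j)))" by (simp add: in_eball_iff)
  qed
  hence "(\<lambda>s. of_bool (i = j) - eval_fps (mass_fps (\<mu> i j)) s) holomorphic_on ball 0 R"
    by (intro holomorphic_intros)
  thus ?thesis using assms by (simp add: renewal_mat_def)
qed

text \<open>Supplies an admissible exponent for the \<open>LEAST\<close> in
  \<open>root_order\<close>. The determinant vanishes at \<open>w\<close> to some finite order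
  \<open>N\<close>; the exponent \<open>Suc N\<close> is admissible and at least 1 even when
  \<open>N = 0\<close>.\<close>

lemma resolvent_holomorphic_exists:
  assumes \<mu>: "\<forall>i<p. \<forall>j<p. lattice_measure (\<mu> i j)"
    and r: "complex_of_real r \<in> laplace_dom p \<mu>" and w: "Re w > r"
    and det0: "Determinant.det (renewal_mat p \<mu> 0) \<noteq> 0"
  shows "\<exists>k\<ge>1. resolvent_holomorphic p \<mu> w k"
proof -
  define R where "R = exp (- r)"
  define S where "S = {z :: complex. Re z > r}"
  define A where "A z = renewal_mat p \<mu> (exp (- z))" for z
  define D where "D s = Determinant.det (renewal_mat p \<mu> s)" for s
  have S: "open S" "connected S" "w \<in> S"
    using w by (auto simp: S_def open_halfspace_Re_gt intro!: convex_connected convex_halfspace_Re_gt)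
  have dom: "z \<in> laplace_dom p \<mu>" if "z \<in> S" for z
    using that by (intro laplace_dom_mono[OF \<mu> r]) (auto simp: S_def)
  have rad: "fps_conv_radius (mass_fps (\<mu> i j)) \<ge> ereal R" if "i < p" "j < p" for i j
    unfolding R_def using conv_radius_mass_fps[OF \<mu> r] that by blast
  have e: "exp (- z) \<in> ball 0 R" if "z \<in> S" for z
    using that by (auto simp: S_def R_def norm_exp_eq_Re)
  have holA: "(\<lambda>z. A z $$ (i, j)) holomorphic_on S" if "i < p" "j < p" for i j
  proof -
    have "(\<lambda>s. renewal_mat p \<mu> s $$ (i, j)) \<circ> (\<lambda>z. exp (- z)) holomorphic_on S"
      using e by (intro holomorphic_on_compose_gen[OF _ renewal_mat_holomorphic[OF rad that]] holomorphic_intros) auto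
    thus ?thesis by (simp add: A_def o_def)
  qed
  have Ac: "A z \<in> carrier_mat p p" for z by (simp add: A_def)
  have holdet: "(\<lambda>z. Determinant.det (A z)) holomorphic_on S"
    by (rule holomorphic_on_det[OF Ac holA])
  \<comment> \<open>Far to the right \<open>exp (- t)\<close> tends to 0, where the determinant is
    nonzero; by continuity it cannot vanish for all large \<open>t\<close>.\<close>
  have "\<exists>z\<in>S. Determinant.det (A z) \<noteq> 0"
  proof -
    have "D holomorphic_on ball 0 R"
      unfolding D_def by (intro holomorphic_on_det[of _ p] renewal_mat_holomorphic rad) auto
    hence "isCont D 0"
      using continuous_on_interior[OF holomorphic_on_imp_continuous_on, of D "ball 0 R" 0]
      by (simp add: R_def)
    moreover have "((\<lambda>t. complex_of_real (exp (- t))) \<longlongrightarrow> complex_of_real 0) at_top"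
      by (intro tendsto_of_real) real_asymp
    hence "((\<lambda>t. complex_of_real (exp (- t))) \<longlongrightarrow> 0) at_top" by simp
    ultimately have "((\<lambda>t. D (complex_of_real (exp (- t)))) \<longlongrightarrow> D 0) at_top"
      by (rule isCont_tendsto_compose)
    hence "eventually (\<lambda>t. D (complex_of_real (exp (- t))) \<noteq> 0) at_top"
      by (rule tendsto_imp_eventually_ne) (use det0 in \<open>simp add: D_def\<close>)
    moreover have "eventually (\<lambda>t. t > r) at_top" by (rule eventually_gt_at_top)
    ultimately have "eventually (\<lambda>t. t > r \<and> D (complex_of_real (exp (- t))) \<noteq> 0) at_top"
      by eventually_elim simp
    then obtain t where t: "t > r" "D (complex_of_real (exp (- t))) \<noteq> 0"
      using eventually_happens[of _ "at_top :: real filter"] by auto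
    have "complex_of_real t \<in> S" using t by (simp add: S_def)
    moreover have "exp (- complex_of_real t) = complex_of_real (exp (- t))"
      by (simp add: exp_of_real[symmetric])
    hence "Determinant.det (A (complex_of_real t)) \<noteq> 0"
      using t(2) by (simp add: A_def D_def)
    ultimately show ?thesis by blast
  qed
  \<comment> \<open>Connectedness of the half-plane \<open>S\<close> carries the nonvanishing over
    to \<open>w\<close>, ruling out a zero of infinite order.\<close>
  from zorder_exist_zero[OF holdet S this] obtain N g \<rho> where
    g: "\<rho> > 0" "cball w \<rho> \<subseteq> S" "g holomorphic_on cball w \<rho>"
      "\<And>z. z \<in> cball w \<rho> \<Longrightarrow> Determinant.det (A z) = g z * (z - w) ^ N"
      "\<And>z. z \<in> cball w \<rho> \<Longrightarrow> g z \<noteq> 0"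
    by metis
  have bS: "ball w \<rho> \<subseteq> S" and bc: "ball w \<rho> \<subseteq> cball w \<rho>" using g(2) ball_subset_cball by blast+
  have "resolvent_holomorphic p \<mu> w (Suc N)"
    unfolding resolvent_holomorphic_def
  proof (intro exI[of _ \<rho>] conjI g(1))
    show "ball w \<rho> \<subseteq> laplace_dom p \<mu>" using bS dom by blast
    \<comment> \<open>This is \<open>(z - w) ^ Suc N\<close> times adjugate over determinant, with
      \<open>(z - w) ^ N\<close> cancelled; one factor \<open>z - w\<close> is left over.\<close>
    define G where "G i j z = (z - w) * adj_mat (A z) $$ (i, j) / g z" for i j z
    show "\<exists>G. (\<forall>i<p. \<forall>j<p. G i j holomorphic_on ball w \<rho>) \<and>
          (\<forall>z\<in>ball w \<rho> - {w}. \<exists>R. mat_inverse (1\<^sub>m p - laplace_mat p \<mu> z) = Some R \<and>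
             (\<forall>i<p. \<forall>j<p. G i j z = (z - w) ^ Suc N * R $$ (i, j)))"
    proof (intro exI[of _ G] conjI allI impI ballI)
      fix i j assume ij: "i < p" "j < p"
      have "(\<lambda>z. adj_mat (A z) $$ (i, j)) holomorphic_on ball w \<rho>"
        by (rule holomorphic_on_subset[OF _ bS], rule holomorphic_on_adj_mat[OF Ac holA]) (use ij in auto)
      moreover have "g holomorphic_on ball w \<rho>" by (rule holomorphic_on_subset[OF g(3) bc])
      ultimately show "G i j holomorphic_on ball w \<rho>"
        unfolding G_def using g(5) bc by (intro holomorphic_intros) auto
    next
      fix z assume z: "z \<in> ball w \<rho> - {w}"
      hence zc: "z \<in> cball w \<rho>" and ne: "z - w \<noteq> 0" and zd: "z \<in> laplace_dom p \<mu>"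
        using bc bS dom by auto
      have "Determinant.det (A z) \<noteq> 0" using g(4)[OF zc] g(5)[OF zc] ne by simp
      then obtain R where R: "mat_inverse (A z) = Some R"
        using mat_inverse_exists[OF Ac] by blast
      have "G i j z = (z - w) ^ Suc N * R $$ (i, j)" if "i < p" "j < p" for i j
        unfolding mat_inverse_index[OF Ac R that] g(4)[OF zc] G_def
        using ne g(5)[OF zc] by simp
      thus "\<exists>R. mat_inverse (1\<^sub>m p - laplace_mat p \<mu> z) = Some R \<and>
             (\<forall>i<p. \<forall>j<p. G i j z = (z - w) ^ Suc N * R $$ (i, j))"
        using R unfolding laplace_mat_eq[OF \<mu> zd] A_def by blast
    qed
  qed
  thus ?thesis by (intro exI[of _ "Suc N"]) auto
qed

text \<open>
  The pole order transfers from \<open>z\<close> to \<open>s = exp (- z)\<close> because the quotient of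
  \<open>exp (- z) - exp (- w)\<close> by \<open>z - w\<close> has a finite limit at \<open>w\<close>.
\<close>

lemma resolvent_holomorphic_pole_bound:
  assumes \<mu>: "\<forall>i<p. \<forall>j<p. lattice_measure (\<mu> i j)"
    and res: "resolvent_holomorphic p \<mu> w k" and ij: "i < p" "j < p"
  shows "(\<lambda>s. (s - exp (- w)) ^ k *
            (adj_mat (renewal_mat p \<mu> s) $$ (i, j) / Determinant.det (renewal_mat p \<mu> s)))
         \<in> O[at (exp (- w))](\<lambda>_. 1)"
proof -
  define U where "U s = adj_mat (renewal_mat p \<mu> s) $$ (i, j) / Determinant.det (renewal_mat p \<mu> s)" for s
  define a where "a = exp (- w)"
  have a: "a \<noteq> 0" by (simp add: a_def)
  from res obtain \<rho> G where \<rho>: "\<rho> > 0" "ball w \<rho> \<subseteq> laplace_dom p \<mu>" and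
    G: "\<forall>i<p. \<forall>j<p. G i j holomorphic_on ball w \<rho>"
       "\<forall>z \<in> ball w \<rho> - {w}. \<exists>R. mat_inverse (1\<^sub>m p - laplace_mat p \<mu> z) = Some R \<and>
             (\<forall>i<p. \<forall>j<p. G i j z = (z - w) ^ k * R $$ (i, j))"
    unfolding resolvent_holomorphic_def by blast
  have GU: "G i j z = (z - w) ^ k * U (exp (- z))" if z: "z \<in> ball w \<rho> - {w}" for z
  proof -
    have "z \<in> laplace_dom p \<mu>" using z \<rho> by blast
    moreover obtain R where "mat_inverse (1\<^sub>m p - laplace_mat p \<mu> z) = Some R"
        "G i j z = (z - w) ^ k * R $$ (i, j)"
      using G(2) z ij by blast
    ultimately show ?thesis
      using mat_inverse_index[OF renewal_mat_carrier(2) _ ij] by (simp add: U_def laplace_mat_eq[OF \<mu>])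
  qed
  have "isCont (G i j) w"
    using G(1) ij \<rho>(1)
    by (intro continuous_on_interior[OF holomorphic_on_imp_continuous_on[of _ "ball w \<rho>"]]) auto
  hence G_lim: "G i j \<midarrow>w\<rightarrow> G i j w" by (simp add: isCont_def)
  have "((\<lambda>z. exp (- z)) has_field_derivative - a) (at w)"
    unfolding a_def by (auto intro!: derivative_eq_intros)
  hence "(\<lambda>z. (exp (- z) - a) / (z - w)) \<midarrow>w\<rightarrow> - a"
    by (simp add: has_field_derivative_iff a_def)
  hence "(\<lambda>z. ((exp (- z) - a) / (z - w)) ^ k * G i j z) \<midarrow>w\<rightarrow> (- a) ^ k * G i j w"
    by (intro tendsto_intros G_lim)
  moreover have "eventually (\<lambda>z. ((exp (- z) - a) / (z - w)) ^ k * G i j z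
                    = (exp (- z) - a) ^ k * U (exp (- z))) (at w)"
  proof (rule eventually_mono)
    show "eventually (\<lambda>z. z \<in> ball w \<rho> - {w}) (at w)"
      using \<rho>(1) by (intro eventually_at_in_open) auto
  qed (auto simp: GU power_divide)
  ultimately have lim: "(\<lambda>z. (exp (- z) - a) ^ k * U (exp (- z))) \<midarrow>w\<rightarrow> (- a) ^ k * G i j w"
    by (rule Lim_transform_eventually)
  \<comment> \<open>A local inverse of \<open>z \<mapsto> exp (- z)\<close> sending \<open>a\<close>
    back to \<open>w\<close>. Dividing by \<open>a\<close> keeps the argument of \<open>Ln\<close>
    near 1, away from the branch cut.\<close>
  have Ln_a: "(\<lambda>s. w - Ln (s / a)) \<midarrow>a\<rightarrow> w"
  proof -
    have "(\<lambda>s. w - Ln (s / a)) \<midarrow>a\<rightarrow> w - Ln (a / a)"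
      using a by (intro tendsto_intros) auto
    thus ?thesis using a by simp
  qed
  have exp_Ln_a: "exp (- (w - Ln (s / a))) = s" if "s \<noteq> 0" for s
    using that a by (simp add: exp_diff exp_minus a_def field_simps)
  have ne0: "eventually (\<lambda>s. s \<noteq> 0) (at a)"
    using eventually_at_in_open'[of "- {0}" a] a by (auto elim!: eventually_mono)
  \<comment> \<open>The limit at \<open>w\<close> concerns punctured neighbourhoods, so the inverse
    must also avoid the value \<open>w\<close> for \<open>s\<close> different from
    \<open>a\<close>.\<close>
  have "filterlim (\<lambda>s. w - Ln (s / a)) (at w) (at a)"
  proof (rule filterlim_atI[OF Ln_a])
    have "eventually (\<lambda>s. s \<noteq> a) (at a)" by (simp add: eventually_at_filter)
    with ne0 show "eventually (\<lambda>s. w - Ln (s / a) \<noteq> w) (at a)"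
    proof eventually_elim
      case (elim s)
      show ?case
      proof
        assume "w - Ln (s / a) = w"
        with exp_Ln_a[OF elim(1)] elim(2) show False by (simp add: a_def)
      qed
    qed
  qed
  from filterlim_compose[OF lim this]
  have "(\<lambda>s. (exp (- (w - Ln (s / a))) - a) ^ k * U (exp (- (w - Ln (s / a))))) \<midarrow>a\<rightarrow> (- a) ^ k * G i j w" .
  moreover have "eventually (\<lambda>s. (exp (- (w - Ln (s / a))) - a) ^ k * U (exp (- (w - Ln (s / a))))
                   = (s - a) ^ k * U s) (at a)"
    using ne0
  proof eventually_elim
    case (elim s)
    show ?case unfolding exp_Ln_a[OF elim] ..
  qed
  ultimately have "(\<lambda>s. (s - a) ^ k * U s) \<midarrow>a\<rightarrow> (- a) ^ k * G i j w"
    by (rule Lim_transform_eventually)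
  hence "(\<lambda>s. (s - a) ^ k * U s) \<in> O[at a](\<lambda>_. 1)"
    by (intro bigoI_tendsto[where c = "(- a) ^ k * G i j w"]) auto
  thus ?thesis unfolding U_def a_def .
qed

section \<open>Growth of \<open>f\<close>, and roots as zeros in a disc\<close>

lemma exp_bound_of_summable:
  fixes f :: "nat \<Rightarrow> real"
  assumes "summable (\<lambda>n. f n * exp (- \<theta> * real n))"
  obtains C where "\<And>n. norm (complex_of_real (f n)) \<le> C * exp (\<theta> * real n)"
proof -
  \<comment> \<open>The terms of a convergent series tend to 0 and are therefore bounded;
    conditional convergence suffices.\<close>
  have "Bseq (\<lambda>n. f n * exp (- \<theta> * real n))"
    using summable_LIMSEQ_zero[OF assms] by (intro convergent_imp_Bseq) (auto simp: convergent_def)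
  then obtain C where C: "\<And>n. norm (f n * exp (- \<theta> * real n)) \<le> C"
    by (auto simp: Bseq_def)
  have "norm (complex_of_real (f n)) \<le> C * exp (\<theta> * real n)" for n
  proof -
    have "\<bar>f n\<bar> = norm (f n * exp (- \<theta> * real n)) * exp (\<theta> * real n)"
      by (simp add: abs_mult exp_minus)
    also have "\<dots> \<le> C * exp (\<theta> * real n)" by (intro mult_right_mono C) auto
    finally show ?thesis by simp
  qed
  thus ?thesis using that by blast
qed

text \<open>The strip in \<open>char_roots\<close> is the range of the principal logarithm, so a
  zero \<open>s\<close> comes from the root \<open>Ln (inverse s)\<close>; here \<open>s\<close> is
  nonzero by the hypothesis on the determinant at 0. The condition \<open>r < \<theta>\<close> keeps
  that root in the domain.\<close>

lemma char_roots_above_image: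
  assumes \<mu>: "\<forall>i<p. \<forall>j<p. lattice_measure (\<mu> i j)"
    and r: "complex_of_real r \<in> laplace_dom p \<mu>" "r < \<theta>"
    and det0: "Determinant.det (renewal_mat p \<mu> 0) \<noteq> 0"
  shows "(\<lambda>w. exp (- w)) ` char_roots_above p \<mu> \<theta>
           = {s \<in> ball 0 (exp (- \<theta>)). Determinant.det (renewal_mat p \<mu> s) = 0}"
proof (intro equalityI subsetI)
  fix s assume "s \<in> (\<lambda>w. exp (- w)) ` char_roots_above p \<mu> \<theta>"
  then obtain w where w: "s = exp (- w)" "w \<in> laplace_dom p \<mu>" "Re w > \<theta>"
      "Determinant.det (1\<^sub>m p - laplace_mat p \<mu> w) = 0"
    by (auto simp: char_roots_above_def char_roots_def)
  thus "s \<in> {s \<in> ball 0 (exp (- \<theta>)). Determinant.det (renewal_mat p \<mu> s) = 0}"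
    by (simp add: laplace_mat_eq[OF \<mu>] norm_exp_eq_Re)
next
  fix s assume s: "s \<in> {s \<in> ball 0 (exp (- \<theta>)). Determinant.det (renewal_mat p \<mu> s) = 0}"
  hence s0: "s \<noteq> 0" using det0 by auto
  define w where "w = Ln (inverse s)"
  have exp_w: "exp (- w) = s" using s0 by (simp add: w_def exp_minus)
  have "norm s < exp (- \<theta>)" using s by simp
  hence "exp (- Re w) < exp (- \<theta>)" using exp_w norm_exp_eq_Re[of "- w"] by simp
  hence w: "Re w > \<theta>" by simp
  have dom: "w \<in> laplace_dom p \<mu>"
    using w r by (intro laplace_dom_mono[OF \<mu> r(1)]) auto
  have "- pi < Im w" "Im w \<le> pi"
    unfolding w_def using s0 by (auto intro: mpi_less_Im_Ln Im_Ln_le_pi)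
  moreover have "Determinant.det (1\<^sub>m p - laplace_mat p \<mu> w) = 0"
    using s by (simp add: laplace_mat_eq[OF \<mu> dom] exp_w)
  ultimately have "w \<in> char_roots_above p \<mu> \<theta>"
    using w dom by (simp add: char_roots_above_def char_roots_def)
  thus "s \<in> (\<lambda>w. exp (- w)) ` char_roots_above p \<mu> \<theta>" using exp_w by blast
qed

text \<open>On the strip containing the roots, \<open>Ln\<close> inverts \<open>exp\<close>.\<close>

lemma inj_on_exp_char_roots_above: "inj_on (\<lambda>w. exp (- w)) (char_roots_above p \<mu> \<theta>)"
proof (rule inj_onI)
  fix v w assume vw: "v \<in> char_roots_above p \<mu> \<theta>" "w \<in> char_roots_above p \<mu> \<theta>"
    and "exp (- v) = exp (- w)"
  hence "exp v = exp w" by (simp add: exp_minus)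
  hence "Ln (exp v) = Ln (exp w)" by simp
  thus "v = w" using vw by (simp add: char_roots_above_def char_roots_def)
qed

section \<open>The asymptotic expansion of the renewal solution\<close>

theorem theorem2p8:
  fixes p :: nat
    and \<mu> :: "nat \<Rightarrow> nat \<Rightarrow> real measure"
    and \<theta>\<^sub>0 \<theta> :: real
    and f :: "nat \<Rightarrow> real Matrix.vec"
  assumes "p \<ge> 1"
    and "\<forall>i<p. \<forall>j<p. lattice_measure (\<mu> i j)"
    and "complex_of_real \<theta>\<^sub>0 \<in> interior (laplace_dom p \<mu>)"
    and "spectral_radius (map_mat complex_of_real (mass_mat p \<mu> 0)) < 1"
    and "\<theta> > \<theta>\<^sub>0"
    and "char_roots_above p \<mu> \<theta>\<^sub>0 = char_roots_above p \<mu> \<theta>"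
    and "\<forall>n. f n \<in> carrier_vec p"
    and "\<forall>i<p. summable (\<lambda>n. f n $ i * exp (- \<theta> * real n))"
  shows "\<exists>F. markov_renewal_solution p \<mu> f F \<and>
           (\<forall>G. markov_renewal_solution p \<mu> f G \<longrightarrow> G = F) \<and>
           finite (char_roots_above p \<mu> \<theta>) \<and>
           (\<exists>b :: complex \<Rightarrow> nat \<Rightarrow> complex Matrix.vec.
              (\<forall>w \<in> char_roots_above p \<mu> \<theta>. \<forall>k < root_order p \<mu> w. b w k \<in> carrier_vec p) \<and>
              (\<forall>i<p. (\<lambda>n. complex_of_real (F n $ i) -
                        (\<Sum>w \<in> char_roots_above p \<mu> \<theta>. exp (w * of_nat n) *
                           (\<Sum>k < root_order p \<mu> w. of_nat n ^ k * b w k $ i)))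
                     \<in> O(\<lambda>n. complex_of_real (exp (\<theta> * real n)))))"
proof -
  note \<mu> = assms(2)
  define W where "W = char_roots_above p \<mu> \<theta>"
  define A where "A = renewal_mat p \<mu>"
  define B where "B = renewal_fps_mat p \<mu>"
  define D where "D s = Determinant.det (A s)" for s
  have carr: "A s \<in> carrier_mat p p" "B \<in> carrier_mat p p" for s
    by (simp_all add: A_def B_def)
  \<comment> \<open>The interior hypothesis gives room to the left of
    \<open>\<theta>\<^sub>0\<close>, so that everything is holomorphic on a disc containing the
    closed disc of radius \<open>R0\<close>.\<close>
  obtain r where r: "complex_of_real r \<in> laplace_dom p \<mu>" "r < \<theta>\<^sub>0"
  proof -
    obtain e where e: "e > 0" "ball (complex_of_real \<theta>\<^sub>0) e \<subseteq> laplace_dom p \<mu>"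
      using assms(3) by (auto simp: mem_interior)
    have "dist (complex_of_real \<theta>\<^sub>0) (complex_of_real (\<theta>\<^sub>0 - e / 2)) < e"
      using e(1) by (simp add: dist_norm flip: of_real_diff)
    hence "complex_of_real (\<theta>\<^sub>0 - e / 2) \<in> laplace_dom p \<mu>" using e(2) by (auto simp: subset_iff)
    thus ?thesis using that[of "\<theta>\<^sub>0 - e / 2"] e(1) by simp
  qed
  define R where "R = exp (- r)"
  define R0 where "R0 = exp (- \<theta>\<^sub>0)"
  have R: "0 < R0" "R0 < R" "exp (- \<theta>) < R0" using r assms(5) by (simp_all add: R_def R0_def)
  have rad: "fps_conv_radius (mass_fps (\<mu> i j)) \<ge> ereal R" if "i < p" "j < p" for i j
    unfolding R_def using conv_radius_mass_fps[OF \<mu> r(1)] that by blast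
  have rad0: "fps_conv_radius (mass_fps (\<mu> i j)) > 0" if "i < p" "j < p" for i j
    by (rule order.strict_trans2[OF _ rad[OF that]]) (use R in simp)
  have holA: "(\<lambda>s. A s $$ (i, j)) holomorphic_on ball 0 R" if "i < p" "j < p" for i j
    unfolding A_def by (rule renewal_mat_holomorphic[OF rad that])
  have holD: "D holomorphic_on ball 0 R"
    unfolding D_def by (rule holomorphic_on_det[OF carr(1) holA])
  have A_exp: "(\<lambda>s. A s $$ (i, j)) has_fps_expansion B $$ (i, j)" if "i < p" "j < p" for i j
    unfolding A_def B_def using renewal_mat_has_fps_expansion[OF rad0 that] .
  have D_exp: "D has_fps_expansion Determinant.det B"
    unfolding D_def by (rule has_fps_expansion_det[OF carr(2,1) A_exp])
  \<comment> \<open>At \<open>s = 0\<close> only the masses at 0 remain, and the spectral radius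
    hypothesis applies to them.\<close>
  have D0: "D 0 \<noteq> 0"
    unfolding D_def A_def renewal_mat_0
    by (rule det_one_minus_ne_0) (use assms(1,4) in \<open>auto simp: mass_mat_def\<close>)
  have det0: "fps_nth (Determinant.det B) 0 \<noteq> 0"
    using has_fps_expansion_imp_0_eq_fps_nth_0[OF D_exp] D0 by simp
  \<comment> \<open>The equality of the two root sets acts here: the roots above \<theta> already
    account for all zeros in the larger disc of radius \<open>R0\<close>, so none lies at modulus
    between \<open>exp (- \<theta>)\<close> and \<open>R0\<close>.\<close>
  have W_image: "(\<lambda>w. exp (- w)) ` W = {s \<in> ball 0 R0. D s = 0}"
    unfolding W_def assms(6)[symmetric] R0_def D_def A_def
    using D0 by (intro char_roots_above_image[OF \<mu> r]) (simp add: D_def A_def)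
  have inj: "inj_on (\<lambda>w. exp (- w)) W"
    unfolding W_def by (rule inj_on_exp_char_roots_above)
  \<comment> \<open>A nonconstant holomorphic function has finitely many zeros in a compact disc; a
    constant \<open>D\<close> has none because \<open>D 0\<close> is nonzero.\<close>
  have "finite {s \<in> cball 0 R0. D s = 0}"
  proof (cases "D constant_on ball 0 R")
    case True
    then obtain c where c: "\<And>s. s \<in> ball 0 R \<Longrightarrow> D s = c" by (auto simp: constant_on_def)
    hence "c \<noteq> 0" using D0 c[of 0] R by simp
    hence "{s \<in> cball 0 R0. D s = 0} = {}" using c R by auto
    thus ?thesis by (simp only: finite.emptyI)
  next
    case False
    thus ?thesis using R by (intro holomorphic_compact_finite_zeros[OF holD]) auto
  qed
  hence "finite ((\<lambda>w. exp (- w)) ` W)"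
    unfolding W_image by (rule rev_finite_subset) auto
  hence finW: "finite W" by (rule finite_imageD[OF _ inj])
  have W_Re: "Re w > \<theta>" if "w \<in> W" for w
    using that by (simp add: W_def char_roots_above_def)
  define U where "U i j s = adj_mat (A s) $$ (i, j) / D s" for i j s
  define u where "u i j = adj_mat B $$ (i, j) / Determinant.det B" for i j
  have U_hol: "U i j holomorphic_on ball 0 R0 - (\<lambda>w. exp (- w)) ` W"
    if ij: "i < p" "j < p" for i j
  proof -
    have sub: "ball 0 R0 - (\<lambda>w. exp (- w)) ` W \<subseteq> ball 0 R" using R by auto
    have "(\<lambda>s. adj_mat (A s) $$ (i, j)) holomorphic_on ball 0 R"
      by (rule holomorphic_on_adj_mat[OF carr(1) holA ij])
    from holomorphic_on_subset[OF this sub] holomorphic_on_subset[OF holD sub]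
    show ?thesis unfolding U_def W_image by (intro holomorphic_on_divide) auto
  qed
  have U_exp: "U i j has_fps_expansion u i j" if ij: "i < p" "j < p" for i j
    unfolding U_def u_def
    by (rule has_fps_expansion_divide'[OF has_fps_expansion_adj_mat[OF carr(2,1) A_exp ij] D_exp det0])
  have poles: "(\<lambda>s. (s - exp (- w)) ^ root_order p \<mu> w * U i j s) \<in> O[at (exp (- w))](\<lambda>_. 1)"
    if ij: "i < p" "j < p" and w: "w \<in> W" for i j w
  proof -
    have "Re w > r" using W_Re[OF w] r(2) assms(5) by simp
    from resolvent_holomorphic_exists[OF \<mu> r(1) this] D0
    have "\<exists>k. 1 \<le> k \<and> resolvent_holomorphic p \<mu> w k" unfolding D_def A_def by blast
    hence "resolvent_holomorphic p \<mu> w (root_order p \<mu> w)"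
      unfolding root_order_def by (rule LeastI2_ex) blast
    from resolvent_holomorphic_pole_bound[OF \<mu> this ij] show ?thesis
      unfolding U_def D_def A_def .
  qed
  obtain F :: "nat \<Rightarrow> real Matrix.vec" where F: "markov_renewal_solution p \<mu> f F"
      "\<forall>G. markov_renewal_solution p \<mu> f G \<longrightarrow> G = F"
      "\<forall>i<p. \<forall>n. complex_of_real (F n $ i) = (\<Sum>j<p. \<Sum>m\<le>n.
        fps_nth (u i j) (n - m) * complex_of_real (f m $ j))"
    using markov_renewal_solution_exists_unique[OF assms(7) det0[unfolded B_def]]
    unfolding u_def B_def by blast
  have "exp_poly_approx W (root_order p \<mu>) \<theta> (\<lambda>n. complex_of_real (F n $ i))" if i: "i < p" for i
  proof -
    have "exp_poly_approx W (root_order p \<mu>) \<theta>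
            (\<lambda>n. \<Sum>m\<le>n. fps_nth (u i j) (n - m) * complex_of_real (f m $ j))" if j: "j < p" for j
    proof -
      have "summable (\<lambda>n. f n $ j * exp (- \<theta> * real n))" using assms(8) j by blast
      from exp_bound_of_summable[OF this]
      obtain C where C: "\<And>n. norm (complex_of_real (f n $ j)) \<le> C * exp (\<theta> * real n)"
        by blast
      show ?thesis
        by (rule exp_poly_approx_meromorphic_conv[OF finW inj W_Re R(3) U_hol[OF i j]
              U_exp[OF i j] poles[OF i j] C])
    qed
    hence "exp_poly_approx W (root_order p \<mu>) \<theta>
            (\<lambda>n. \<Sum>j<p. \<Sum>m\<le>n. fps_nth (u i j) (n - m) * complex_of_real (f m $ j))"
      by (intro exp_poly_approx_sum) simp
    thus ?thesis using F(3) i by simp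
  qed
  \<comment> \<open>The coefficients are obtained for each component separately. Placing
    \<open>i < p\<close> under the existential lets choice yield a total function of
    \<open>i\<close>, whose values are then assembled into vectors.\<close>
  hence "\<forall>i. \<exists>b. i < p \<longrightarrow> (\<lambda>n. complex_of_real (F n $ i) -
           (\<Sum>w\<in>W. exp (w * of_nat n) * (\<Sum>k<root_order p \<mu> w. of_nat n ^ k * b w k)))
         \<in> O(\<lambda>n. complex_of_real (exp (\<theta> * real n)))"
    unfolding exp_poly_approx_def by blast
  from choice[OF this] obtain b :: "nat \<Rightarrow> complex \<Rightarrow> nat \<Rightarrow> complex" where b: "\<And>i. i < p \<Longrightarrow> (\<lambda>n. complex_of_real (F n $ i) -
           (\<Sum>w\<in>W. exp (w * of_nat n) * (\<Sum>k<root_order p \<mu> w. of_nat n ^ k * b i w k)))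
         \<in> O(\<lambda>n. complex_of_real (exp (\<theta> * real n)))"
    by blast
  show ?thesis
  proof (intro exI[of _ F] exI[of _ "\<lambda>w k. Matrix.vec p (\<lambda>i. b i w k)"] conjI F(1,2))
    show "finite (char_roots_above p \<mu> \<theta>)" using finW by (simp add: W_def)
  qed (use b in \<open>simp_all add: W_def\<close>)
qed

end
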